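(* Let $d\ge 1$, $\beta>0$, and let $Z=(Z(t))_{t\ge 0}$ be a strictly dyadic branching Brownian motion in $\mathbb{R}^d$ with constant branching rate $\beta$, started from a single particle at the origin. Let $0\le\theta<1$ and let $B$ be a fixed (open) ball in $\mathbb{R}^d$. Let $\mathbf{e}$ be the unit vector in the direction of the center of $B$ if $B$ is not centered at the origin; otherwise let $\mathbf{e}$ be any unit vector. For $t\ge 0$ define $B_t=B+\theta\sqrt{2\beta}\,t\,\mathbf{e}$. Then $$\lim_{t\to\infty}\frac1t\log P\left(Z_t(B_t)=0\right)=-2\beta(\sqrt2-1)(1-\theta).$$
   Context: Strictly dyadic branching Brownian motion (BBM) with constant branching rate $\beta>0$: the process starts with a single particle, which performs a standard Brownian motion in $\mathbb{R}^d$ for a random exponential time of parameter $\beta$; it then dies and simultaneously gives birth to exactly two offspring at its death position; each offspring, independently of everything else, repeats the same procedure started from that position, and so on. All Brownian motions and exponential lifetimes are independent. $P$ is the law of $Z$ when started with a single particle at the origin. For a Borel set $A\subseteq\mathbb{R}^d$, $Z_t(A)$ is the number of particles located in $A$ at time $t$. For $x\in\mathbb{R}^d$, $A+x=\{y+x:y\in A\}$. *)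

theory Defs
  imports "HOL-Probability.Probability"
begin

text \<open>
  The processes below are indexed by \<^typ>\<open>real\<close>, but only times \<open>t \<ge> 0\<close> matter. Path continuity and
  nonnegativity of lifetimes are required surely rather than almost surely: on a probability space
  that need not be complete this makes the events considered later measurable.
\<close>

locale standard_brownian_motion = prob_space M
  for M :: "'w measure" and W :: "real \<Rightarrow> 'w \<Rightarrow> 'a::euclidean_space" +
  assumes random_variable_BM: "\<And>t. 0 \<le> t \<Longrightarrow> random_variable borel (W t)"
    and start_BM: "\<And>\<omega>. \<omega> \<in> space M \<Longrightarrow> W 0 \<omega> = 0"
    and continuous_BM: "\<And>\<omega>. \<omega> \<in> space M \<Longrightarrow> continuous_on {0..} (\<lambda>t. W t \<omega>)"
    and gaussian_increments_BM:
      "\<And>s t. 0 \<le> s \<Longrightarrow> s < t \<Longrightarrow>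
        distributed M lborel (\<lambda>\<omega>. W t \<omega> - W s \<omega>)
          (\<lambda>x. ennreal (\<Prod>b\<in>Basis. normal_density 0 (sqrt (t - s)) (x \<bullet> b)))"
    and indep_increments_BM:
      "\<And>(\<tau> :: nat \<Rightarrow> real) n. 0 \<le> \<tau> 0 \<Longrightarrow> mono \<tau> \<Longrightarrow>
        indep_vars (\<lambda>_. borel) (\<lambda>k \<omega>. W (\<tau> (Suc k)) \<omega> - W (\<tau> k) \<omega>) {..<n}"

text \<open>
  Particles are labelled by \<^typ>\<open>bool list\<close>: the initial particle is \<open>[]\<close> and the two offspring of
  \<open>u\<close> are \<open>False # u\<close> and \<open>True # u\<close>. Particle \<open>u\<close> has lifetime \<open>T u\<close>, and \<open>W u\<close> is its displacement
  from its place of birth, as a function of its age.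
\<close>

locale dyadic_branching_brownian_motion = prob_space M
  for M :: "'w measure" and \<beta> :: real
    and T :: "bool list \<Rightarrow> 'w \<Rightarrow> real"
    and W :: "bool list \<Rightarrow> real \<Rightarrow> 'w \<Rightarrow> 'a::euclidean_space" +
  assumes lifetime_nonneg: "\<And>u \<omega>. \<omega> \<in> space M \<Longrightarrow> 0 \<le> T u \<omega>"
    and lifetime_exponential:
      "\<And>u. distributed M lborel (T u) (\<lambda>x. ennreal (exponential_density \<beta> x))"
    and motion_brownian: "\<And>u. standard_brownian_motion M (W u)"
    and indep_lifetimes_motions:
      "indep_sets
        (case_sum
          (\<lambda>u. sets (vimage_algebra (space M) (T u) borel))
          (\<lambda>u. sets (vimage_algebra (space M) (\<lambda>\<omega>. \<lambda>t\<in>{0..}. W u t \<omega>) (Pi\<^sub>M {0..} (\<lambda>_. borel)))))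
        UNIV"

primrec birth_time :: "(bool list \<Rightarrow> 'w \<Rightarrow> real) \<Rightarrow> bool list \<Rightarrow> 'w \<Rightarrow> real" where
  "birth_time T [] \<omega> = 0"
| "birth_time T (b # u) \<omega> = birth_time T u \<omega> + T u \<omega>"

primrec birth_place ::
  "(bool list \<Rightarrow> 'w \<Rightarrow> real) \<Rightarrow> (bool list \<Rightarrow> real \<Rightarrow> 'w \<Rightarrow> 'a::euclidean_space) \<Rightarrow>
    bool list \<Rightarrow> 'w \<Rightarrow> 'a" where
  "birth_place T W [] \<omega> = 0"
| "birth_place T W (b # u) \<omega> = birth_place T W u \<omega> + W u (T u \<omega>) \<omega>"

definition alive :: "(bool list \<Rightarrow> 'w \<Rightarrow> real) \<Rightarrow> real \<Rightarrow> 'w \<Rightarrow> bool list set" where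
  "alive T t \<omega> = {u. birth_time T u \<omega> \<le> t \<and> t < birth_time T u \<omega> + T u \<omega>}"

definition position ::
  "(bool list \<Rightarrow> 'w \<Rightarrow> real) \<Rightarrow> (bool list \<Rightarrow> real \<Rightarrow> 'w \<Rightarrow> 'a::euclidean_space) \<Rightarrow>
    bool list \<Rightarrow> real \<Rightarrow> 'w \<Rightarrow> 'a" where
  "position T W u t \<omega> = birth_place T W u \<omega> + W u (t - birth_time T u \<omega>) \<omega>"

text \<open>
  The counting measure is used instead of \<^const>\<open>card\<close>, which would be \<open>0\<close> on an infinite set of
  particles.
\<close>

definition particle_count ::
  "(bool list \<Rightarrow> 'w \<Rightarrow> real) \<Rightarrow> (bool list \<Rightarrow> real \<Rightarrow> 'w \<Rightarrow> 'a::euclidean_space) \<Rightarrow>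
    real \<Rightarrow> 'a set \<Rightarrow> 'w \<Rightarrow> ennreal" where
  "particle_count T W t A \<omega> =
    emeasure (count_space UNIV) {u \<in> alive T t \<omega>. position T W u t \<omega> \<in> A}"

definition translate :: "'a::ab_group_add set \<Rightarrow> 'a \<Rightarrow> 'a set" where
  "translate A x = {y + x | y. y \<in> A}"

end

theory Submission
  imports Defs "HOL-Real_Asymp.Real_Asymp"
begin

text \<open>
  Let \<open>w t x\<close> be the probability that no particle of the process started at \<open>x\<close> lies in \<open>ball 0 r\<close> at
  time \<open>t\<close>. Decomposing at the first branching shows that \<open>w\<close> is a mild solution of
  \<open>w\<^sub>t = \<Delta>w/2 + \<beta>(w\<^sup>2 - w)\<close>, and from there on the argument is analytic; every comparison
  principle is a contraction in a norm weighted by \<open>exp (-3\<beta>t)\<close>.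

  Lower bound: the initial particle does not branch up to time \<open>s = (1 - \<theta>) t / sqrt 2\<close> and moves so
  far that the expected number of particles in the ball at time \<open>t\<close> becomes small.

  Upper bound: \<open>w\<close> is arbitrarily small on \<open>norm x \<le> c t\<close> for every \<open>c < sqrt (2\<beta>)\<close>. There the
  quadratic term is negligible, so \<open>w\<close> is dominated by finite sums of exponentials
  \<open>exp (b (n \<bullet> x) - b c t)\<close> over unit vectors \<open>n\<close>, which solve the linearised equation if
  \<open>b\<^sup>2/2 + b c = \<beta>\<close>. With \<open>c = sqrt (2\<beta>)\<close> this gives \<open>b = sqrt (2\<beta>) (sqrt 2 - 1)\<close>, hence the rate
  \<open>2\<beta>(sqrt 2 - 1)(1 - \<theta>)\<close>.
\<close>

section \<open>Brownian motion and the heat semigroup\<close>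

text \<open>Only measurability, bounds and an integral equation are available for \<open>w\<close>;
  no derivative ever occurs. Comparison therefore looks at the truncated difference of two
  functions. The nonlinearity has Lipschitz constant 2 on [0, 1], so this difference is at most
  \<open>Q\<close> applied to twice itself, which the weight turns into a contraction with factor
  1/2. Subtrees with different root labels are different random objects, so the avoidance
  probability carries a label until the same contraction shows that the label is irrelevant.
  Smallness of \<open>w\<close> comes in two stages: first \<open>w\<close> is kept away from 1
  inside the cone, then waiting for a branching squares any such bound. The time s minimises a cost:
  with s = \<sigma>t, not branching costs \<beta>\<sigma>t, and moving from radius \<theta>
  sqrt(2\<beta>) t to sqrt(2\<beta>)(1 - \<sigma>)t costs \<beta>(1 - \<theta> - \<sigma>)^2
  t/\<sigma>.\<close>

lemma borel_measurable_continuous_paths: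
  fixes X :: "real \<Rightarrow> 'w \<Rightarrow> 'b::{metric_space, second_countable_topology}"
  assumes [measurable]: "\<And>t. 0 \<le> t \<Longrightarrow> X t \<in> borel_measurable N"
    and cont: "\<And>\<omega>. \<omega> \<in> space N \<Longrightarrow> continuous_on {0..} (\<lambda>t. X t \<omega>)"
  shows "(\<lambda>p. X (max 0 (fst p)) (snd p)) \<in> borel_measurable (borel \<Otimes>\<^sub>M N)"
\<comment> \<open>Rounding the time down to a multiple of \<open>1 / Suc n\<close> leaves only
  countably many times, each giving a measurable map; continuity of paths passes to the
  limit.\<close>
proof (rule borel_measurable_LIMSEQ_metric)
  fix n :: nat
  show "(\<lambda>p. X (real (nat \<lfloor>real (Suc n) * max 0 (fst p)\<rfloor>) / real (Suc n)) (snd p))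
      \<in> borel_measurable (borel \<Otimes>\<^sub>M N)"
  proof (rule measurable_compose_countable[where f = "\<lambda>i p. X (real i / real (Suc n)) (snd p)"])
    fix i :: nat
    have [measurable]: "X (real i / real (Suc n)) \<in> borel_measurable N" by simp
    show "(\<lambda>p. X (real i / real (Suc n)) (snd p)) \<in> borel_measurable (borel \<Otimes>\<^sub>M N)"
      by measurable
  qed measurable
next
  fix p :: "real \<times> 'w" assume p: "p \<in> space (borel \<Otimes>\<^sub>M N)"
  define s where "s = max 0 (fst p)"
  have s: "0 \<le> s" by (simp add: s_def)
  have \<omega>: "snd p \<in> space N" using p by (auto simp: space_pair_measure)
  define q where "q n = real (nat \<lfloor>real (Suc n) * s\<rfloor>) / real (Suc n)" for n
  have "q \<longlonglongrightarrow> s"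
  proof (rule real_tendsto_sandwich)
    have lim: "(\<lambda>n. s - 1 / real (Suc n)) \<longlonglongrightarrow> s - 0"
      by (intro tendsto_diff tendsto_const LIMSEQ_inverse_real_of_nat[simplified inverse_eq_divide])
    then show "(\<lambda>n. s - 1 / real (Suc n)) \<longlonglongrightarrow> s" by simp
    have q: "real (Suc n) * s - 1 \<le> real (nat \<lfloor>real (Suc n) * s\<rfloor>)"
        "real (nat \<lfloor>real (Suc n) * s\<rfloor>) \<le> real (Suc n) * s" for n
    proof -
      have "0 \<le> real (Suc n) * s" using s by simp
      then show "real (Suc n) * s - 1 \<le> real (nat \<lfloor>real (Suc n) * s\<rfloor>)"
        "real (nat \<lfloor>real (Suc n) * s\<rfloor>) \<le> real (Suc n) * s" by linarith+
    qed
    show "\<forall>\<^sub>F n in sequentially. s - 1 / real (Suc n) \<le> q n"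
    proof (intro always_eventually allI)
      fix n
      have "(real (Suc n) * s - 1) / real (Suc n) \<le> q n"
        unfolding q_def by (intro divide_right_mono q(1)) simp
      moreover have "(real (Suc n) * s - 1) / real (Suc n) = s - 1 / real (Suc n)"
        by (simp add: diff_divide_distrib)
      ultimately show "s - 1 / real (Suc n) \<le> q n" by simp
    qed
    show "\<forall>\<^sub>F n in sequentially. q n \<le> s"
      using q(2) unfolding q_def
      by (intro always_eventually allI) (simp add: divide_le_eq mult.commute[of s])
  qed simp
  moreover have "\<forall>\<^sub>F n in sequentially. q n \<in> {0..}" by (simp add: q_def)
  ultimately have "(\<lambda>n. X (q n) (snd p)) \<longlonglongrightarrow> X s (snd p)"
    using continuous_on_tendsto_compose[OF cont[OF \<omega>], of q s sequentially] s by simp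
  then show "(\<lambda>n. X (real (nat \<lfloor>real (Suc n) * max 0 (fst p)\<rfloor>) / real (Suc n)) (snd p))
      \<longlonglongrightarrow> X (max 0 (fst p)) (snd p)"
    by (simp add: q_def s_def)
qed

text \<open>Completing the square: an exponential tilt shifts the mean of a Gaussian by
  \<open>v * \<sigma>\<^sup>2\<close>.\<close>

lemma exp_mult_normal_density:
  assumes "\<sigma> > 0"
  shows "exp (v * x) * normal_density 0 \<sigma> x = exp (v\<^sup>2 * \<sigma>\<^sup>2 / 2) * normal_density (v * \<sigma>\<^sup>2) \<sigma> x"
proof -
  have "v * x + - (x\<^sup>2 / (2 * \<sigma>\<^sup>2)) = v\<^sup>2 * \<sigma>\<^sup>2 / 2 + - ((x - v * \<sigma>\<^sup>2)\<^sup>2 / (2 * \<sigma>\<^sup>2))"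
    using assms by (simp add: field_simps power2_eq_square)
  then show ?thesis
    by (simp add: normal_density_def exp_add[symmetric])
qed

lemma prod_normal_density:
  fixes y :: "'a::euclidean_space"
  assumes "s > 0"
  shows "(\<Prod>b\<in>Basis. normal_density 0 (sqrt s) (y \<bullet> b)) =
    (1 / sqrt (2 * pi * s)) ^ DIM('a) * exp (- (norm y)\<^sup>2 / (2 * s))"
proof -
  have "(norm y)\<^sup>2 = (\<Sum>b\<in>Basis. (y \<bullet> b)\<^sup>2)"
    unfolding power2_norm_eq_inner by (subst euclidean_inner) (simp add: power2_eq_square)
  then show ?thesis
    using assms
    by (simp add: normal_density_def prod_dividef prod.distrib exp_sum[symmetric] sum_divide_distrib
        sum_negf power_one_over)
qed

lemma (in prob_space) indep_vars_imp_indep_var: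
  assumes "indep_vars N X I" "i \<in> I" "j \<in> I" "i \<noteq> j"
  shows "indep_var (N i) (X i) (N j) (X j)"
proof -
  have ind: "indep_sets (\<lambda>i. sigma_sets (space M) {X i -` A \<inter> space M |A. A \<in> sets (N i)}) I"
    using assms(1) by (simp add: indep_vars_def)
  have "prob (a \<inter> b) = prob a * prob b"
    if "a \<in> sigma_sets (space M) {X i -` A \<inter> space M |A. A \<in> sets (N i)}"
      "b \<in> sigma_sets (space M) {X j -` A \<inter> space M |A. A \<in> sets (N j)}" for a b
    using indep_setsD[OF ind, of "{i, j}" "\<lambda>k. if k = i then a else b"] assms that
    by (auto simp: Int_commute mult.commute)
  moreover have "sigma_sets (space M) {X k -` A \<inter> space M |A. A \<in> sets (N k)} \<subseteq> events" if "k \<in> I" for k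
    using ind that by (auto simp: indep_sets_def)
  ultimately show ?thesis
    using assms unfolding indep_var_eq indep_sets2_eq by (auto simp: indep_vars_def)
qed

text \<open>\<open>max 0 s\<close> makes the heat semigroup jointly measurable in \<open>s\<close> and \<open>x\<close> without side conditions.\<close>

definition heat :: "'w measure \<Rightarrow> (real \<Rightarrow> 'w \<Rightarrow> 'a) \<Rightarrow> real \<Rightarrow> ('a::euclidean_space \<Rightarrow> ennreal) \<Rightarrow> 'a \<Rightarrow> ennreal"
  where "heat M W s f x = (\<integral>\<^sup>+\<omega>. f (x + W (max 0 s) \<omega>) \<partial>M)"

context standard_brownian_motion
begin

abbreviation P where "P \<equiv> heat M W"

lemma W_measurable[measurable]: "(\<lambda>p. W (max 0 (fst p)) (snd p)) \<in> borel_measurable (borel \<Otimes>\<^sub>M M)"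
  by (intro borel_measurable_continuous_paths random_variable_BM continuous_BM)

lemma W_measurable_fixed[measurable]: "W (max 0 s) \<in> borel_measurable M"
  by (rule random_variable_BM) simp

lemma P_measurable:
  assumes [measurable]: "(\<lambda>p. F (fst p) (snd p)) \<in> borel_measurable (N \<Otimes>\<^sub>M borel)"
    "\<sigma> \<in> borel_measurable N" "\<xi> \<in> borel_measurable N"
  shows "(\<lambda>p. P (\<sigma> p) (F p) (\<xi> p)) \<in> borel_measurable N"
proof -
  have [measurable]: "(\<lambda>p. W (max 0 (\<sigma> (fst p))) (snd p)) \<in> borel_measurable (N \<Otimes>\<^sub>M M)"
    using measurable_compose[OF _ W_measurable, of "\<lambda>p. (\<sigma> (fst p), snd p)" "N \<Otimes>\<^sub>M M"] by simp
  have "(\<lambda>p. F (fst p) (\<xi> (fst p) + W (max 0 (\<sigma> (fst p))) (snd p))) \<in> borel_measurable (N \<Otimes>\<^sub>M M)"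
    using measurable_compose[OF _ assms(1),
        of "\<lambda>p. (fst p, \<xi> (fst p) + W (max 0 (\<sigma> (fst p))) (snd p))" "N \<Otimes>\<^sub>M M"] by simp
  then show ?thesis unfolding heat_def
    by (intro borel_measurable_nn_integral) (simp add: case_prod_unfold)
qed

lemma P_measurable1:
  assumes [measurable]: "f \<in> borel_measurable borel"
  shows "P s f \<in> borel_measurable borel"
  by (rule P_measurable[where F = "\<lambda>_. f" and \<sigma> = "\<lambda>_. s" and \<xi> = "\<lambda>x. x"]) measurable

lemma P_mono: "(\<And>y. f y \<le> g y) \<Longrightarrow> P s f x \<le> P s g x"
  unfolding heat_def by (intro nn_integral_mono)

lemma P_const: "P s (\<lambda>_. c) x = c"
  unfolding heat_def by (simp add: emeasure_space_1)

lemma P_add: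
  assumes [measurable]: "f \<in> borel_measurable borel" "g \<in> borel_measurable borel"
  shows "P s (\<lambda>y. f y + g y) x = P s f x + P s g x"
  unfolding heat_def by (intro nn_integral_add) measurable

lemma P_cmult:
  assumes [measurable]: "f \<in> borel_measurable borel"
  shows "P s (\<lambda>y. c * f y) x = c * P s f x"
  unfolding heat_def by (intro nn_integral_cmult) measurable

lemma P_sum:
  assumes [measurable]: "\<And>i. i \<in> I \<Longrightarrow> f i \<in> borel_measurable borel"
  shows "P s (\<lambda>y. \<Sum>i\<in>I. f i y) x = (\<Sum>i\<in>I. P s (f i) x)"
  unfolding heat_def by (intro nn_integral_sum) measurable

lemma P_0: "P 0 f x = f x"
proof -
  have "(\<integral>\<^sup>+\<omega>. f (x + W (max 0 0) \<omega>) \<partial>M) = (\<integral>\<^sup>+\<omega>. f x \<partial>M)"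
    by (intro nn_integral_cong) (simp add: start_BM)
  then show ?thesis by (simp add: heat_def emeasure_space_1)
qed

lemma P_nn_integral:
  assumes "sigma_finite_measure N"
    and [measurable]: "(\<lambda>p. F (fst p) (snd p)) \<in> borel_measurable (N \<Otimes>\<^sub>M borel)"
  shows "P s (\<lambda>y. \<integral>\<^sup>+i. F i y \<partial>N) x = (\<integral>\<^sup>+i. P s (F i) x \<partial>N)"
proof -
  interpret N: sigma_finite_measure N by fact
  interpret pair_sigma_finite N M ..
  have "(\<lambda>p. F (fst p) (x + W (max 0 s) (snd p))) \<in> borel_measurable (N \<Otimes>\<^sub>M M)"
    using measurable_compose[OF _ assms(2), of "\<lambda>p. (fst p, x + W (max 0 s) (snd p))" "N \<Otimes>\<^sub>M M"]
    by simp
  then show ?thesis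
    unfolding heat_def by (intro Fubini') (simp add: case_prod_unfold)
qed

lemma increment_distr:
  assumes "0 \<le> s" "0 \<le> t"
  shows "distr M borel (\<lambda>\<omega>. W (s + t) \<omega> - W s \<omega>) = distr M borel (W t)"
proof (cases "t = 0")
  case True
  then show ?thesis by (intro distr_cong) (auto simp: start_BM)
next
  case False
  with assms have t: "0 < t" by simp
  have d: "distr M lborel (\<lambda>\<omega>. W (s + t) \<omega> - W s \<omega>) = density lborel
      (\<lambda>x. ennreal (\<Prod>b\<in>Basis. normal_density 0 (sqrt t) (x \<bullet> b)))" if "0 \<le> s" for s
    using gaussian_increments_BM[of s "s + t"] that t by (simp add: distributed_def)
  have "distr M borel (W t) = distr M lborel (\<lambda>\<omega>. W (0 + t) \<omega> - W 0 \<omega>)"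
    by (intro distr_cong) (auto simp: start_BM)
  also have "\<dots> = distr M lborel (\<lambda>\<omega>. W (s + t) \<omega> - W s \<omega>)"
    using d[of 0] d[OF assms(1)] by simp
  also have "\<dots> = distr M borel (\<lambda>\<omega>. W (s + t) \<omega> - W s \<omega>)"
    by (intro distr_cong) auto
  finally show ?thesis by simp
qed

lemma P_density:
  assumes s: "0 < s" and [measurable]: "f \<in> borel_measurable borel"
  shows "P s f x = (\<integral>\<^sup>+y. ennreal (\<Prod>b\<in>Basis. normal_density 0 (sqrt s) (y \<bullet> b)) * f (x + y) \<partial>lborel)"
proof -
  have D: "distributed M lborel (\<lambda>\<omega>. W s \<omega> - W 0 \<omega>)
      (\<lambda>x. ennreal (\<Prod>b\<in>Basis. normal_density 0 (sqrt s) (x \<bullet> b)))"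
    using gaussian_increments_BM[of 0 s] s by simp
  have "P s f x = (\<integral>\<^sup>+\<omega>. f (x + (W s \<omega> - W 0 \<omega>)) \<partial>M)"
    unfolding heat_def using s by (intro nn_integral_cong) (simp add: start_BM)
  also have "\<dots> = (\<integral>\<^sup>+y. ennreal (\<Prod>b\<in>Basis. normal_density 0 (sqrt s) (y \<bullet> b)) * f (x + y) \<partial>lborel)"
    by (rule distributed_nn_integral[OF D, symmetric]) measurable
  finally show ?thesis .
qed

text \<open>Chapman-Kolmogorov. Independence is known for increments only, hence the detour through
  \<open>W s - W 0\<close> and \<open>W (s + t) - W s\<close>; \<open>increment_distr\<close> gives
  stationarity.\<close>

lemma P_P:
  assumes s: "0 \<le> s" and t: "0 \<le> t" and [measurable]: "f \<in> borel_measurable borel"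
  shows "P s (P t f) x = P (s + t) f x"
proof -
  \<comment> \<open>\<open>indep_increments_BM\<close> takes a monotone grid indexed by all
    naturals, so the three times 0, \<open>s\<close>, \<open>s + t\<close> are continued by a
    constant.\<close>
  define \<tau> :: "nat \<Rightarrow> real" where "\<tau> k = (if k = 0 then 0 else if k = 1 then s else s + t)" for k
  have [measurable]: "W s \<in> borel_measurable M" "W t \<in> borel_measurable M"
    "W (s + t) \<in> borel_measurable M" "W 0 \<in> borel_measurable M"
    using s t by (auto intro: random_variable_BM)
  have "indep_vars (\<lambda>_. borel) (\<lambda>k \<omega>. W (\<tau> (Suc k)) \<omega> - W (\<tau> k) \<omega>) {..<2}"
    using s t by (intro indep_increments_BM) (auto simp: \<tau>_def mono_def)
  then have "indep_var borel (\<lambda>\<omega>. W (\<tau> (Suc 0)) \<omega> - W (\<tau> 0) \<omega>) borel (\<lambda>\<omega>. W (\<tau> (Suc 1)) \<omega> - W (\<tau> 1) \<omega>)"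
    by (rule indep_vars_imp_indep_var[where i = 0 and j = 1, simplified]) auto
  then have ind: "indep_var borel (\<lambda>\<omega>. W s \<omega> - W 0 \<omega>) borel (\<lambda>\<omega>. W (s + t) \<omega> - W s \<omega>)"
    by (simp add: \<tau>_def)
  interpret A: prob_space "distr M borel (W t)" by (rule prob_space_distr) measurable
  have "P (s + t) f x = (\<integral>\<^sup>+\<omega>. f (x + (W s \<omega> - W 0 \<omega>) + (W (s + t) \<omega> - W s \<omega>)) \<partial>M)"
    unfolding heat_def using s t by (intro nn_integral_cong) (simp add: start_BM)
  also have "\<dots> = (\<integral>\<^sup>+p. f (x + fst p + snd p) \<partial>distr M (borel \<Otimes>\<^sub>M borel)
      (\<lambda>\<omega>. (W s \<omega> - W 0 \<omega>, W (s + t) \<omega> - W s \<omega>)))"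
    by (subst nn_integral_distr) auto
  also have "\<dots> = (\<integral>\<^sup>+p. f (x + fst p + snd p)
      \<partial>(distr M borel (\<lambda>\<omega>. W s \<omega> - W 0 \<omega>) \<Otimes>\<^sub>M distr M borel (W t)))"
    using ind unfolding indep_var_distribution_eq increment_distr[OF s t] by simp
  also have "\<dots> = (\<integral>\<^sup>+y. \<integral>\<^sup>+z. f (x + y + z) \<partial>distr M borel (W t) \<partial>distr M borel (\<lambda>\<omega>. W s \<omega> - W 0 \<omega>))"
    by (subst A.nn_integral_fst[symmetric]) auto
  also have "\<dots> = (\<integral>\<^sup>+\<omega>. (\<integral>\<^sup>+z. f (x + (W s \<omega> - W 0 \<omega>) + z) \<partial>distr M borel (W t)) \<partial>M)"
    by (subst nn_integral_distr) auto
  also have "\<dots> = P s (P t f) x"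
    unfolding heat_def using s t by (intro nn_integral_cong) (simp add: nn_integral_distr start_BM)
  finally show ?thesis by simp
qed

text \<open>Exponentials are eigenfunctions of the heat semigroup: the Gaussian factorises over
  coordinates and each factor is tilted separately. These are the plane waves behind the upper
  bound.\<close>

lemma P_exp:
  assumes s: "0 \<le> s"
  shows "P s (\<lambda>y. ennreal (exp (v \<bullet> y))) x = ennreal (exp ((norm v)\<^sup>2 * s / 2) * exp (v \<bullet> x))"
proof (cases "s = 0")
  case True
  then show ?thesis by (simp add: P_0)
next
  case False
  with s have s: "0 < s" by simp
  have nv: "(norm v)\<^sup>2 = (\<Sum>b\<in>Basis. (v \<bullet> b)\<^sup>2)"
    unfolding power2_norm_eq_inner by (subst euclidean_inner) (simp add: power2_eq_square)
  have "P s (\<lambda>y. ennreal (exp (v \<bullet> y))) x =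
    (\<integral>\<^sup>+y. ennreal (\<Prod>b\<in>Basis. normal_density 0 (sqrt s) (y \<bullet> b)) * ennreal (exp (v \<bullet> (x + y))) \<partial>lborel)"
    by (rule P_density[OF s]) measurable
  also have "\<dots> = (\<integral>\<^sup>+y. ennreal (exp (v \<bullet> x)) * (\<Prod>b\<in>Basis.
      ennreal (exp ((v \<bullet> b)\<^sup>2 * s / 2) * normal_density ((v \<bullet> b) * s) (sqrt s) (y \<bullet> b))) \<partial>lborel)"
  proof (intro nn_integral_cong)
    fix y :: 'a
    have "(\<Prod>b\<in>Basis. normal_density 0 (sqrt s) (y \<bullet> b)) * exp (v \<bullet> y)
        = (\<Prod>b\<in>Basis. exp ((v \<bullet> b) * (y \<bullet> b)) * normal_density 0 (sqrt s) (y \<bullet> b))"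
      by (subst (2) euclidean_inner) (simp add: exp_sum prod.distrib)
    also have "\<dots> = (\<Prod>b\<in>Basis. exp ((v \<bullet> b)\<^sup>2 * s / 2) * normal_density ((v \<bullet> b) * s) (sqrt s) (y \<bullet> b))"
      using s exp_mult_normal_density[of "sqrt s"] by simp
    finally show "ennreal (\<Prod>b\<in>Basis. normal_density 0 (sqrt s) (y \<bullet> b)) * ennreal (exp (v \<bullet> (x + y))) =
      ennreal (exp (v \<bullet> x)) * (\<Prod>b\<in>Basis.
      ennreal (exp ((v \<bullet> b)\<^sup>2 * s / 2) * normal_density ((v \<bullet> b) * s) (sqrt s) (y \<bullet> b)))"
      by (simp add: prod_ennreal ennreal_mult[symmetric] prod_nonneg inner_add_right exp_add mult_ac)
  qed
  also have "\<dots> = ennreal (exp (v \<bullet> x)) * (\<Prod>b\<in>Basis. \<integral>\<^sup>+y.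
      ennreal (exp ((v \<bullet> b)\<^sup>2 * s / 2) * normal_density ((v \<bullet> b) * s) (sqrt s) y) \<partial>lborel)"
    by (subst nn_integral_cmult) (measurable, subst nn_integral_lborel_prod, auto)
  also have "(\<lambda>b. \<integral>\<^sup>+y. ennreal (exp ((v \<bullet> b)\<^sup>2 * s / 2) * normal_density ((v \<bullet> b) * s) (sqrt s) y) \<partial>lborel)
      = (\<lambda>b. ennreal (exp ((v \<bullet> b)\<^sup>2 * s / 2)))"
  proof
    fix b
    interpret N: prob_space "density lborel (normal_density ((v \<bullet> b) * s) (sqrt s))"
      using s by (intro prob_space_normal_density) simp
    have "(\<integral>\<^sup>+y. ennreal (normal_density ((v \<bullet> b) * s) (sqrt s) y) \<partial>lborel) = 1"
      using N.emeasure_space_1 by (simp add: emeasure_density)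
    then show "(\<integral>\<^sup>+y. ennreal (exp ((v \<bullet> b)\<^sup>2 * s / 2) * normal_density ((v \<bullet> b) * s) (sqrt s) y) \<partial>lborel)
      = ennreal (exp ((v \<bullet> b)\<^sup>2 * s / 2))"
      by (simp add: ennreal_mult nn_integral_cmult)
  qed
  also have "ennreal (exp (v \<bullet> x)) * (\<Prod>b\<in>Basis. ennreal (exp ((v \<bullet> b)\<^sup>2 * s / 2)))
      = ennreal (exp ((norm v)\<^sup>2 * s / 2) * exp (v \<bullet> x))"
    by (simp add: nv prod_ennreal exp_sum[symmetric] ennreal_mult[symmetric] sum_divide_distrib
        sum_distrib_left sum_distrib_right mult_ac)
  finally show ?thesis .
qed

text \<open>Every displacement from \<open>x\<close> into the ball has norm at most
  \<open>R + r\<close>, and the Gaussian density decreases in the norm, so volume times density at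
  that radius is a lower bound.\<close>

lemma P_ball_ge:
  assumes s: "0 < s" and R: "norm (x - z) \<le> R" and r: "0 \<le> r"
  shows "ennreal (measure lborel (ball 0 r :: 'a set) * (1 / sqrt (2 * pi * s)) ^ DIM('a)
      * exp (- (R + r)\<^sup>2 / (2 * s))) \<le> P s (indicator (ball z r)) x"
proof -
  define c where "c = (1 / sqrt (2 * pi * s)) ^ DIM('a) * exp (- (R + r)\<^sup>2 / (2 * s))"
  have c: "0 \<le> c" using s by (simp add: c_def)
  have vol: "emeasure lborel (ball (z - x) r) = ennreal (measure lborel (ball 0 r :: 'a set))"
    using r emeasure_eq_ennreal_measure[of lborel "ball (z - x) r"] emeasure_lborel_ball_finite[of "z - x" r]
    by (simp add: content_ball less_top)
  have "ennreal (measure lborel (ball 0 r :: 'a set) * c) = ennreal c * emeasure lborel (ball (z - x) r)"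
    using c by (simp add: vol ennreal_mult mult.commute)
  also have "\<dots> = (\<integral>\<^sup>+y. ennreal c * indicator (ball (z - x) r) y \<partial>lborel)"
    by (simp add: nn_integral_cmult_indicator)
  also have "\<dots> \<le> (\<integral>\<^sup>+y. ennreal (\<Prod>b\<in>Basis. normal_density 0 (sqrt s) (y \<bullet> b))
      * indicator (ball z r) (x + y) \<partial>lborel)"
  proof (intro nn_integral_mono)
    fix y :: 'a
    show "ennreal c * indicator (ball (z - x) r) y \<le> ennreal (\<Prod>b\<in>Basis. normal_density 0 (sqrt s) (y \<bullet> b))
      * indicator (ball z r) (x + y)"
    proof (cases "y \<in> ball (z - x) r")
      case True
      then have n: "norm (z - x - y) < r" by (simp add: dist_norm)
      have "norm y \<le> R + r"
        using n R norm_triangle_ineq4[of "z - x" "z - x - y"] by (simp add: norm_minus_commute)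
      then have "c \<le> (\<Prod>b\<in>Basis. normal_density 0 (sqrt s) (y \<bullet> b))"
        unfolding prod_normal_density[OF s] c_def using s
        by (intro mult_left_mono) (auto intro!: divide_right_mono power_mono)
      moreover have "x + y \<in> ball z r" using n by (simp add: dist_norm algebra_simps)
      ultimately show ?thesis using True by (simp add: ennreal_leI)
    qed simp
  qed
  also have "\<dots> = P s (indicator (ball z r)) x"
    by (rule P_density[OF s, symmetric]) (intro borel_measurable_indicator borel_open open_ball)
  finally show ?thesis by (simp add: c_def mult.assoc)
qed

end

section \<open>The mild equation\<close>

text \<open>\<open>duhamel\<close> is the mild form of \<open>u\<^sub>t = \<Delta>u/2 - \<beta>u + \<beta>g\<close>, \<open>u(0) = f\<close>.\<close>

definition duhamel ::
  "'w measure \<Rightarrow> (real \<Rightarrow> 'w \<Rightarrow> 'a) \<Rightarrow> real \<Rightarrow> real \<Rightarrow>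
    ('a::euclidean_space \<Rightarrow> ennreal) \<Rightarrow> (real \<Rightarrow> 'a \<Rightarrow> ennreal) \<Rightarrow> 'a \<Rightarrow> ennreal"
  where "duhamel M W \<beta> h f g x = ennreal (exp (- \<beta> * h)) * heat M W h f x +
    (\<integral>\<^sup>+s\<in>{0..h}. ennreal (\<beta> * exp (- \<beta> * s)) * heat M W s (g (h - s)) x \<partial>lborel)"

lemma nn_integral_exp_Icc:
  assumes "0 \<le> h" "0 < k" "0 \<le> c"
  shows "(\<integral>\<^sup>+s\<in>{0..h}. ennreal (c * exp (- k * s)) \<partial>lborel) = ennreal (c / k * (1 - exp (- k * h)))"
proof -
  have "(\<integral>\<^sup>+s\<in>{0..h}. ennreal (c * exp (- k * s)) \<partial>lborel)
      = ennreal (- c / k * exp (- k * h) - - c / k * exp (- k * 0))"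
    using assms
    by (intro nn_integral_FTC_Icc) (auto intro!: derivative_eq_intros simp: field_simps)
  also have "- c / k * exp (- k * h) - - c / k * exp (- k * 0) = c / k * (1 - exp (- k * h))"
    by (simp add: algebra_simps)
  finally show ?thesis .
qed

lemma nn_integral_exp_Ioi:
  fixes k t :: real
  assumes "0 < k"
  shows "(\<integral>\<^sup>+s\<in>{t<..}. ennreal (k * exp (- k * s)) \<partial>lborel) = ennreal (exp (- k * t))"
proof -
  have "((\<lambda>s. - exp (- (k * s))) \<longlongrightarrow> - 0) at_top"
    using assms by (intro tendsto_minus filterlim_compose[OF exp_at_bot] filterlim_uminus_at_bot_at_top[THEN filterlim_compose]
      filterlim_tendsto_pos_mult_at_top[OF tendsto_const] filterlim_ident)
  then have "(\<integral>\<^sup>+s\<in>{t..}. ennreal (k * exp (- k * s)) \<partial>lborel) = ennreal (0 - - exp (- k * t))"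
    using assms by (intro nn_integral_FTC_atLeast) (auto intro!: derivative_eq_intros)
  moreover have "(\<integral>\<^sup>+s\<in>{t<..}. ennreal (k * exp (- k * s)) \<partial>lborel) = (\<integral>\<^sup>+s\<in>{t..}. ennreal (k * exp (- k * s)) \<partial>lborel)"
    using AE_lborel_singleton[of t] by (intro nn_integral_cong_AE) (auto elim!: AE_mp split: split_indicator)
  ultimately show ?thesis by simp
qed

locale branching_heat = standard_brownian_motion M W
  for M :: "'w measure" and W :: "real \<Rightarrow> 'w \<Rightarrow> 'a::euclidean_space" +
  fixes \<beta> :: real
  assumes \<beta>_pos: "0 < \<beta>"
begin

abbreviation Q where "Q \<equiv> duhamel M W \<beta>"

lemma Q_mono:
  assumes "\<And>y. f y \<le> f' y" "\<And>u y. 0 \<le> u \<Longrightarrow> u \<le> h \<Longrightarrow> g u y \<le> g' u y"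
  shows "Q h f g x \<le> Q h f' g' x"
  unfolding duhamel_def using assms
  by (intro add_mono mult_left_mono P_mono nn_integral_mono) (auto split: split_indicator intro!: mult_left_mono P_mono)

lemma Q_0: "Q 0 f g x = f x"
  unfolding duhamel_def by (simp add: P_0 nn_integral_null_set)

lemma P_flow_measurable:
  assumes [measurable]: "(\<lambda>p. g (fst p) (snd p)) \<in> borel_measurable (borel \<Otimes>\<^sub>M borel)"
    "\<sigma> \<in> borel_measurable N" "\<rho> \<in> borel_measurable N" "\<xi> \<in> borel_measurable N"
  shows "(\<lambda>p. P (\<sigma> p) (g (\<rho> p)) (\<xi> p)) \<in> borel_measurable N"
proof -
  have [measurable]: "(\<lambda>p. g (\<rho> (fst p)) (snd p)) \<in> borel_measurable (N \<Otimes>\<^sub>M borel)"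
    using measurable_compose[OF _ assms(1), of "\<lambda>p. (\<rho> (fst p), snd p)" "N \<Otimes>\<^sub>M borel"] by simp
  show ?thesis by (rule P_measurable) measurable
qed

lemma section_measurable:
  assumes "(\<lambda>p. g (fst p) (snd p)) \<in> borel_measurable (borel \<Otimes>\<^sub>M borel)"
  shows "g u \<in> borel_measurable borel"
  using measurable_compose[OF _ assms, of "\<lambda>y. (u, y)" borel] by simp

lemma Q_add:
  assumes [measurable]: "f \<in> borel_measurable borel" "f' \<in> borel_measurable borel"
  and g: "(\<lambda>p. g (fst p) (snd p)) \<in> borel_measurable (borel \<Otimes>\<^sub>M borel)"
    "(\<lambda>p. g' (fst p) (snd p)) \<in> borel_measurable (borel \<Otimes>\<^sub>M borel)"
  shows "Q h (\<lambda>y. f y + f' y) (\<lambda>u y. g u y + g' u y) x = Q h f g x + Q h f' g' x"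
proof -
  note [measurable] = section_measurable[OF g(1)] section_measurable[OF g(2)]
    P_flow_measurable[OF g(1)] P_flow_measurable[OF g(2)]
  show ?thesis
    unfolding duhamel_def
    by (simp add: P_add distrib_left distrib_right nn_integral_add add_ac)
qed

lemma nn_integral_branching: "0 \<le> h \<Longrightarrow>
  (\<integral>\<^sup>+s\<in>{0..h}. ennreal (\<beta> * exp (- \<beta> * s)) * c \<partial>lborel) = ennreal (1 - exp (- \<beta> * h)) * c"
proof -
  assume h: "0 \<le> h"
  have "(\<integral>\<^sup>+s\<in>{0..h}. ennreal (\<beta> * exp (- \<beta> * s)) * c \<partial>lborel)
      = (\<integral>\<^sup>+s. ennreal (\<beta> * exp (- \<beta> * s)) * indicator {0..h} s * c \<partial>lborel)"
    by (simp add: mult_ac)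
  then show ?thesis
    using nn_integral_exp_Icc[OF h \<beta>_pos, of \<beta>] \<beta>_pos by (simp add: nn_integral_multc)
qed

lemma Q_const: "0 \<le> h \<Longrightarrow> Q h (\<lambda>_. c) (\<lambda>_ _. d) x = ennreal (exp (- \<beta> * h)) * c + ennreal (1 - exp (- \<beta> * h)) * d"
  unfolding duhamel_def by (simp only: P_const nn_integral_branching)

lemma Q_one: "0 \<le> h \<Longrightarrow> Q h (\<lambda>_. 1) (\<lambda>_ _. 1) x = 1"
  using \<beta>_pos by (simp add: Q_const ennreal_plus[symmetric] del: ennreal_plus)

text \<open>Flow property of the mild equation. After \<open>P h\<close> is applied, the inner
  integral over \<open>{0..t}\<close> becomes, by a shift of the branching time by \<open>h\<close>,
  the part of the full integral over \<open>{h..t + h}\<close>.\<close>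

lemma Q_Q:
  assumes t: "0 \<le> t" and h: "0 \<le> h" and f[measurable]: "f \<in> borel_measurable borel"
    and g: "(\<lambda>p. g (fst p) (snd p)) \<in> borel_measurable (borel \<Otimes>\<^sub>M borel)"
  shows "Q (t + h) f g x = Q h (Q t f g) (\<lambda>u. g (t + u)) x"
proof -
  note [measurable] = section_measurable[OF g] P_flow_measurable[OF g] P_measurable1[OF f]
  have sw: "P h (\<lambda>y. \<integral>\<^sup>+s\<in>{0..t}. ennreal (\<beta> * exp (- \<beta> * s)) * P s (g (t - s)) y \<partial>lborel) x
      = (\<integral>\<^sup>+s. P h (\<lambda>y. ennreal (\<beta> * exp (- \<beta> * s)) * P s (g (t - s)) y * indicator {0..t} s) x \<partial>lborel)"
    by (rule P_nn_integral) (auto intro: lborel.sigma_finite_measure_axioms)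
  have in1: "P h (\<lambda>y. ennreal (\<beta> * exp (- \<beta> * s)) * P s (g (t - s)) y * indicator {0..t} s) x
      = ennreal (\<beta> * exp (- \<beta> * s)) * P (h + s) (g (t - s)) x * indicator {0..t} s" for s
  proof (cases "s \<in> {0..t}")
    case True
    then show ?thesis using P_P[OF h _ section_measurable[OF g], of s] P_measurable1[OF section_measurable[OF g]]
      by (simp add: P_cmult)
  next
    case False
    then show ?thesis by (simp add: P_const)
  qed
  have "ennreal (exp (- \<beta> * h)) * P h (Q t f g) x = ennreal (exp (- \<beta> * (t + h))) * P (t + h) f x +
      ennreal (exp (- \<beta> * h)) * (\<integral>\<^sup>+s\<in>{0..t}. ennreal (\<beta> * exp (- \<beta> * s)) * P (h + s) (g (t - s)) x \<partial>lborel)"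
  proof -
    have "ennreal (exp (- \<beta> * h)) * ennreal (exp (- \<beta> * t)) = ennreal (exp (- \<beta> * (t + h)))"
      by (simp add: ennreal_mult[symmetric] exp_add[symmetric] algebra_simps)
    moreover have "P h (Q t f g) x = ennreal (exp (- \<beta> * t)) * P (t + h) f x +
      (\<integral>\<^sup>+s\<in>{0..t}. ennreal (\<beta> * exp (- \<beta> * s)) * P (h + s) (g (t - s)) x \<partial>lborel)"
      unfolding duhamel_def sw[unfolded in1, symmetric] P_P[OF h t f, unfolded add.commute[of h t], symmetric]
      by (subst P_add) (measurable, subst P_cmult, measurable)
    ultimately show ?thesis
      by (simp only: distrib_left mult.assoc[symmetric])
  qed
  also have "ennreal (exp (- \<beta> * h)) * (\<integral>\<^sup>+s\<in>{0..t}. ennreal (\<beta> * exp (- \<beta> * s)) * P (h + s) (g (t - s)) x \<partial>lborel)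
     = (\<integral>\<^sup>+s. ennreal (\<beta> * exp (- \<beta> * (h + s))) * P (h + s) (g (t + h - (h + s))) x * indicator {h..t + h} (h + s) \<partial>lborel)"
  proof -
    have "ennreal (exp (- \<beta> * h)) * ennreal (\<beta> * exp (- \<beta> * s)) = ennreal (\<beta> * exp (- \<beta> * (h + s)))" for s
      using \<beta>_pos by (simp add: ennreal_mult[symmetric] exp_add[symmetric] distrib_left)
    then show ?thesis
      by (subst nn_integral_cmult[symmetric], measurable)
        (intro nn_integral_cong, auto split: split_indicator simp: mult.assoc[symmetric])
  qed
  also have "\<dots> = (\<integral>\<^sup>+s\<in>{h..t + h}. ennreal (\<beta> * exp (- \<beta> * s)) * P s (g (t + h - s)) x \<partial>lborel)"
    by (subst nn_integral_real_affine[where c = 1 and t = h]) auto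
  finally have e: "ennreal (exp (- \<beta> * h)) * P h (Q t f g) x = ennreal (exp (- \<beta> * (t + h))) * P (t + h) f x +
      (\<integral>\<^sup>+s\<in>{h..t + h}. ennreal (\<beta> * exp (- \<beta> * s)) * P s (g (t + h - s)) x \<partial>lborel)" .
  have "(\<integral>\<^sup>+s\<in>{0..t + h}. ennreal (\<beta> * exp (- \<beta> * s)) * P s (g (t + h - s)) x \<partial>lborel)
    = (\<integral>\<^sup>+s. ennreal (\<beta> * exp (- \<beta> * s)) * P s (g (t + h - s)) x * indicator {h..t + h} s
       + ennreal (\<beta> * exp (- \<beta> * s)) * P s (g (t + h - s)) x * indicator {0..h} s \<partial>lborel)"
    using AE_lborel_singleton[of h] t h
    by (intro nn_integral_cong_AE) (auto elim!: AE_mp split: split_indicator)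
  also have "\<dots> = (\<integral>\<^sup>+s\<in>{h..t + h}. ennreal (\<beta> * exp (- \<beta> * s)) * P s (g (t + h - s)) x \<partial>lborel) +
      (\<integral>\<^sup>+s\<in>{0..h}. ennreal (\<beta> * exp (- \<beta> * s)) * P s (g (t + (h - s))) x \<partial>lborel)"
    by (subst nn_integral_add) (simp_all add: add_diff_eq)
  finally show ?thesis
    unfolding duhamel_def[of M W \<beta> "t + h"] duhamel_def[of M W \<beta> h] e by (simp add: add_ac)
qed

text \<open>A source \<kappa>u changes the killing rate \<beta> into the growth rate (\<kappa> -
  1)\<beta>. Three values matter: \<kappa> = 2 gives expected particle numbers, \<kappa> between 1
  and 2 a subsolution while \<open>v\<close> is small, and \<kappa> below 1 a supersolution where
  \<open>w\<close> is small.\<close>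

lemma Q_linear:
  assumes h: "0 \<le> h" and \<kappa>: "0 < \<kappa>" and f[measurable]: "f \<in> borel_measurable borel"
  shows "Q h f (\<lambda>u y. ennreal \<kappa> * (ennreal (exp ((\<kappa> - 1) * \<beta> * u)) * P u f y)) x
    = ennreal (exp ((\<kappa> - 1) * \<beta> * h)) * P h f x"
proof -
  note [measurable] = P_measurable1[OF f]
  have "(\<integral>\<^sup>+s\<in>{0..h}. ennreal (\<beta> * exp (- \<beta> * s)) *
      P s (\<lambda>y. ennreal \<kappa> * (ennreal (exp ((\<kappa> - 1) * \<beta> * (h - s))) * P (h - s) f y)) x \<partial>lborel)
    = (\<integral>\<^sup>+s. ennreal (\<kappa> * \<beta> * exp ((\<kappa> - 1) * \<beta> * h) * exp (- (\<kappa> * \<beta>) * s)) * indicator {0..h} s * P h f x \<partial>lborel)"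
  proof (intro nn_integral_cong)
    fix s
    have "\<beta> * exp (- \<beta> * s) * (\<kappa> * exp ((\<kappa> - 1) * \<beta> * (h - s)))
        = \<kappa> * \<beta> * exp ((\<kappa> - 1) * \<beta> * h) * exp (- (\<kappa> * \<beta>) * s)"
      by (simp add: exp_add[symmetric] algebra_simps)
    then have "ennreal (\<beta> * exp (- \<beta> * s)) * (ennreal \<kappa> * ennreal (exp ((\<kappa> - 1) * \<beta> * (h - s))))
        = ennreal (\<kappa> * \<beta> * exp ((\<kappa> - 1) * \<beta> * h) * exp (- (\<kappa> * \<beta>) * s))"
      using \<kappa> \<beta>_pos by (simp only: ennreal_mult[symmetric] mult_nonneg_nonneg exp_ge_zero less_imp_le)
    then show "ennreal (\<beta> * exp (- \<beta> * s)) *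
      P s (\<lambda>y. ennreal \<kappa> * (ennreal (exp ((\<kappa> - 1) * \<beta> * (h - s))) * P (h - s) f y)) x * indicator {0..h} s
      = ennreal (\<kappa> * \<beta> * exp ((\<kappa> - 1) * \<beta> * h) * exp (- (\<kappa> * \<beta>) * s)) * indicator {0..h} s * P h f x"
      using \<kappa> \<beta>_pos
      by (auto split: split_indicator simp: P_cmult P_P mult.assoc[symmetric])
  qed
  also have "\<dots> = ennreal (exp ((\<kappa> - 1) * \<beta> * h) * (1 - exp (- (\<kappa> * \<beta>) * h))) * P h f x"
    using nn_integral_exp_Icc[OF h, of "\<kappa> * \<beta>" "\<kappa> * \<beta> * exp ((\<kappa> - 1) * \<beta> * h)"] \<kappa> \<beta>_pos
    by (simp add: nn_integral_multc)
  also have "exp ((\<kappa> - 1) * \<beta> * h) * (1 - exp (- (\<kappa> * \<beta>) * h)) = exp ((\<kappa> - 1) * \<beta> * h) - exp (- \<beta> * h)"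
    by (simp add: exp_add[symmetric] algebra_simps)
  finally have I: "(\<integral>\<^sup>+s\<in>{0..h}. ennreal (\<beta> * exp (- \<beta> * s)) *
      P s (\<lambda>y. ennreal \<kappa> * (ennreal (exp ((\<kappa> - 1) * \<beta> * (h - s))) * P (h - s) f y)) x \<partial>lborel)
    = ennreal (exp ((\<kappa> - 1) * \<beta> * h) - exp (- \<beta> * h)) * P h f x" .
  have "0 \<le> \<kappa> * (\<beta> * h)" using \<kappa> h \<beta>_pos by simp
  then have "- \<beta> * h \<le> (\<kappa> - 1) * \<beta> * h" by (simp add: algebra_simps)
  then have "ennreal (exp (- \<beta> * h)) + ennreal (exp ((\<kappa> - 1) * \<beta> * h) - exp (- \<beta> * h))
      = ennreal (exp ((\<kappa> - 1) * \<beta> * h))"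
    by (subst ennreal_plus[symmetric]) auto
  then show ?thesis
    unfolding duhamel_def I by (simp only: distrib_right[symmetric])
qed

text \<open>One application of \<open>Q\<close> halves the constant in a bound of the form \<open>C exp (3\<beta>h)\<close>.\<close>

lemma Q_contraction:
  fixes D :: "'i \<Rightarrow> real \<Rightarrow> 'a \<Rightarrow> ennreal"
  assumes D1: "\<And>i h x. 0 \<le> h \<Longrightarrow> h \<le> H \<Longrightarrow> D i h x \<le> 1"
    and DQ: "\<And>i. \<exists>j k. \<forall>h x. 0 \<le> h \<longrightarrow> h \<le> H \<longrightarrow> D i h x \<le> Q h (\<lambda>_. 0) (\<lambda>u y. D j u y + D k u y) x"
    and h: "0 \<le> h" "h \<le> H"
  shows "D i h x = 0"
proof -
  have *: "D i h x \<le> ennreal ((1/2) ^ n * exp (3 * \<beta> * h))" if "0 \<le> h" "h \<le> H" for n i h x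
    using that
  proof (induction n arbitrary: i h x)
    case 0
    then have "1 \<le> exp (3 * \<beta> * h)" using \<beta>_pos by simp
    then have "1 \<le> ennreal (exp (3 * \<beta> * h))" using ennreal_leI by fastforce
    then show ?case using D1[OF 0(1,2), of i x] by (auto intro: order_trans)
  next
    case (Suc n)
    let ?c = "(1/2) ^ n :: real"
    obtain j k where jk: "\<And>h x. 0 \<le> h \<Longrightarrow> h \<le> H \<Longrightarrow> D i h x \<le> Q h (\<lambda>_. 0) (\<lambda>u y. D j u y + D k u y) x"
      using DQ[of i] by blast
    have "D i h x \<le> Q h (\<lambda>_. 0) (\<lambda>u y. D j u y + D k u y) x"
      using jk Suc.prems by simp
    also have "\<dots> \<le> Q h (\<lambda>_. 0) (\<lambda>u _. ennreal (2 * ?c * exp (3 * \<beta> * u))) x"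
    proof (rule Q_mono)
      fix u y assume u: "0 \<le> u" "u \<le> h"
      have "D j u y + D k u y \<le> ennreal (?c * exp (3 * \<beta> * u)) + ennreal (?c * exp (3 * \<beta> * u))"
        using Suc.IH u Suc.prems by (intro add_mono) auto
      also have "\<dots> = ennreal (2 * ?c * exp (3 * \<beta> * u))"
        by (simp add: ennreal_plus[symmetric] del: ennreal_plus)
      finally show "D j u y + D k u y \<le> ennreal (2 * ?c * exp (3 * \<beta> * u))" .
    qed simp
    \<comment> \<open>The two terms contribute 2\<beta> times the integral of
      \<open>exp (- 4 * \<beta> * s)\<close>, which is at most 1/2; this is what the exponent 3 in
      the weight is for.\<close>
    also have "\<dots> = (\<integral>\<^sup>+s\<in>{0..h}. ennreal (2 * \<beta> * ?c * exp (3 * \<beta> * h) * exp (- (4 * \<beta>) * s)) \<partial>lborel)"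
    proof -
      have "ennreal (\<beta> * exp (- \<beta> * s)) * ennreal (2 * ?c * exp (3 * \<beta> * (h - s)))
          = ennreal (2 * \<beta> * ?c * exp (3 * \<beta> * h) * exp (- (4 * \<beta>) * s))" for s
      proof -
        have "exp (- \<beta> * s) * exp (3 * \<beta> * (h - s)) = exp (3 * \<beta> * h) * exp (- (4 * \<beta>) * s)"
          by (simp add: exp_add[symmetric] right_diff_distrib)
        then show ?thesis using \<beta>_pos by (simp add: ennreal_mult[symmetric])
      qed
      then show ?thesis unfolding duhamel_def P_const by simp
    qed
    also have "\<dots> = ennreal (2 * \<beta> * ?c * exp (3 * \<beta> * h) / (4 * \<beta>) * (1 - exp (- (4 * \<beta>) * h)))"
      using Suc.prems \<beta>_pos by (intro nn_integral_exp_Icc) auto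
    also have "\<dots> \<le> ennreal ((1/2) ^ Suc n * exp (3 * \<beta> * h))"
      using \<beta>_pos by (intro ennreal_leI) (simp add: field_simps)
    finally show ?case .
  qed
  have "(\<lambda>n. ennreal ((1/2) ^ n * exp (3 * \<beta> * h))) \<longlonglongrightarrow> ennreal (0 * exp (3 * \<beta> * h))"
    by (intro tendsto_ennrealI tendsto_mult tendsto_const LIMSEQ_power_zero) simp
  then have "D i h x \<le> ennreal (0 * exp (3 * \<beta> * h))"
    by (rule LIMSEQ_le_const) (use * h in auto)
  then show ?thesis by simp
qed

text \<open>Subtraction in \<open>ennreal\<close> is truncated, so \<open>X - Y\<close> is the
  positive part of the difference and vanishes exactly when \<open>X \<le> Y\<close> (for finite
  \<open>X\<close>). Hypothesis \<open>le\<close> is a one-sided Lipschitz bound with constant 2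
  between the two sources; it puts the positive part into the scope of
  \<open>Q_contraction\<close>.\<close>

lemma Q_comparison:
  assumes X1: "\<And>h x. 0 \<le> h \<Longrightarrow> h \<le> H \<Longrightarrow> X h x \<le> 1"
    and meas: "(\<lambda>p. X (fst p) (snd p)) \<in> borel_measurable (borel \<Otimes>\<^sub>M borel)"
      "(\<lambda>p. Y (fst p) (snd p)) \<in> borel_measurable (borel \<Otimes>\<^sub>M borel)"
      "(\<lambda>p. g (fst p) (snd p)) \<in> borel_measurable (borel \<Otimes>\<^sub>M borel)"
      "f \<in> borel_measurable borel"
    and X: "\<And>h x. 0 \<le> h \<Longrightarrow> h \<le> H \<Longrightarrow> X h x \<le> Q h f f' x"
    and Y: "\<And>h x. 0 \<le> h \<Longrightarrow> h \<le> H \<Longrightarrow> Q h f g x \<le> Y h x"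
    and le: "\<And>u y. 0 \<le> u \<Longrightarrow> u \<le> H \<Longrightarrow> f' u y \<le> g u y + 2 * (X u y - Y u y)"
    and h: "0 \<le> h" "h \<le> H"
  shows "X h x \<le> Y h x"
proof -
  note [measurable] = meas
  have "X h x - Y h x \<le> Q h (\<lambda>_. 0) (\<lambda>u y. (X u y - Y u y) + (X u y - Y u y)) x"
    if "0 \<le> h" "h \<le> H" for h x
  proof -
    have "X h x \<le> Q h f f' x" using X that by simp
    also have "\<dots> \<le> Q h (\<lambda>y. f y + 0) (\<lambda>u y. g u y + ((X u y - Y u y) + (X u y - Y u y))) x"
      using le that by (intro Q_mono) (auto simp: mult_2)
    also have "\<dots> = Q h f g x + Q h (\<lambda>_. 0) (\<lambda>u y. (X u y - Y u y) + (X u y - Y u y)) x"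
      by (rule Q_add) measurable
    also have "\<dots> \<le> Y h x + Q h (\<lambda>_. 0) (\<lambda>u y. (X u y - Y u y) + (X u y - Y u y)) x"
      using Y that by (intro add_right_mono) auto
    finally show ?thesis using neq_top_trans[OF ennreal_one_neq_top X1[OF that, of x]]
      by (auto simp: ennreal_minus_le_iff)
  qed
  moreover have "X h x - Y h x \<le> 1" if "0 \<le> h" "h \<le> H" for h x
    using X1[OF that, of x] neq_top_trans[OF ennreal_one_neq_top X1[OF that, of x]]
    by (auto simp: ennreal_minus_le_iff intro: order_trans add_increasing)
  ultimately have "X h x - Y h x = 0"
    using Q_contraction[where D = "\<lambda>_::unit. \<lambda>u y. X u y - Y u y" and H = H] h by blast
  moreover have "X h x \<noteq> top" by (rule neq_top_trans[OF ennreal_one_neq_top X1[OF h]])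
  ultimately show ?thesis by (simp add: ennreal_minus_eq_0)
qed

end

section \<open>First-branching decomposition\<close>

text \<open>Freezing. \<open>F\<close> sees the sample point once through \<open>X\<close> and once
  directly, and measurability for \<open>S \<Otimes>\<^sub>M N2\<close> limits the direct dependence
  to \<open>N2\<close>. Hence the joint law is a product measure and Fubini separates the
  two.\<close>

lemma (in prob_space) nn_integral_indep_set:
  assumes X[measurable]: "X \<in> measurable N1 S" and F[measurable]: "F \<in> borel_measurable (S \<Otimes>\<^sub>M N2)"
    and sp: "space N1 = space M" "space N2 = space M"
    and ind: "indep_set (sets N1) (sets N2)"
  shows "(\<integral>\<^sup>+\<omega>. F (X \<omega>, \<omega>) \<partial>M) = (\<integral>\<^sup>+\<omega>. \<integral>\<^sup>+\<omega>'. F (X \<omega>, \<omega>') \<partial>M \<partial>M)"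
proof -
  have sub: "sets N1 \<subseteq> events" "sets N2 \<subseteq> events"
    using ind unfolding indep_sets2_eq by auto
  have [measurable]: "X \<in> measurable M S"
    using X sub(1) sp(1) by (auto simp: measurable_def)
  have [measurable]: "(\<lambda>\<omega>. \<omega>) \<in> measurable M N2"
    using sub(2) sp(2) by (auto simp: measurable_def)
  interpret X: prob_space "distr M S X" by (rule prob_space_distr) measurable
  interpret D: prob_space "distr M N2 (\<lambda>\<omega>. \<omega>)" by (rule prob_space_distr) measurable
  have eq: "distr M S X \<Otimes>\<^sub>M distr M N2 (\<lambda>\<omega>. \<omega>) = distr M (S \<Otimes>\<^sub>M N2) (\<lambda>\<omega>. (X \<omega>, \<omega>))"
  proof (rule pair_measure_eqI)
    fix A B assume "A \<in> sets (distr M S X)" and "B \<in> sets (distr M N2 (\<lambda>\<omega>. \<omega>))"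
    then have A: "A \<in> sets S" and B: "B \<in> sets N2" by simp_all
    let ?A = "X -` A \<inter> space M"
    have "?A \<in> sets N1" using measurable_sets[OF X A] sp(1) by simp
    then have "prob (?A \<inter> B) = prob ?A * prob B"
      using ind B unfolding indep_sets2_eq by blast
    moreover have "(\<lambda>\<omega>. (X \<omega>, \<omega>)) -` (A \<times> B) \<inter> space M = ?A \<inter> B" "(\<lambda>\<omega>. \<omega>) -` B \<inter> space M = B"
      using sets.sets_into_space[OF B] sp(2) by auto
    ultimately show "emeasure (distr M S X) A * emeasure (distr M N2 (\<lambda>\<omega>. \<omega>)) B =
        emeasure (distr M (S \<Otimes>\<^sub>M N2) (\<lambda>\<omega>. (X \<omega>, \<omega>))) (A \<times> B)"
      using A B by (simp add: emeasure_distr emeasure_eq_measure ennreal_mult[symmetric])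
  qed (auto intro: X.sigma_finite_measure_axioms D.sigma_finite_measure_axioms)
  have "(\<integral>\<^sup>+\<omega>. F (X \<omega>, \<omega>) \<partial>M) = integral\<^sup>N (distr M (S \<Otimes>\<^sub>M N2) (\<lambda>\<omega>. (X \<omega>, \<omega>))) F"
    by (simp add: nn_integral_distr)
  also have "\<dots> = (\<integral>\<^sup>+y. \<integral>\<^sup>+\<omega>'. F (y, \<omega>') \<partial>distr M N2 (\<lambda>\<omega>. \<omega>) \<partial>distr M S X)"
    unfolding eq[symmetric] by (rule D.nn_integral_fst[symmetric]) measurable
  also have "\<dots> = (\<integral>\<^sup>+\<omega>. \<integral>\<^sup>+\<omega>'. F (X \<omega>, \<omega>') \<partial>distr M N2 (\<lambda>\<omega>. \<omega>) \<partial>M)"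
    by (subst nn_integral_distr) measurable
  also have "\<dots> = (\<integral>\<^sup>+\<omega>. \<integral>\<^sup>+\<omega>'. F (X \<omega>, \<omega>') \<partial>M \<partial>M)"
  proof (intro nn_integral_cong)
    fix \<omega> assume "\<omega> \<in> space M"
    then have "X \<omega> \<in> space S" by (rule measurable_space[OF \<open>X \<in> measurable M S\<close>])
    then have "(\<lambda>\<omega>'. F (X \<omega>, \<omega>')) \<in> borel_measurable N2" by measurable
    then show "(\<integral>\<^sup>+\<omega>'. F (X \<omega>, \<omega>') \<partial>distr M N2 (\<lambda>\<omega>. \<omega>)) = (\<integral>\<^sup>+\<omega>'. F (X \<omega>, \<omega>') \<partial>M)"
      by (simp add: nn_integral_distr)
  qed
  finally show ?thesis .
qed

text \<open>The recursions strip the head of a label, its most recent branching, whereas the first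
  branching of the tree sits at the far end of the list. These equations move the recursion to that
  end.\<close>

lemma birth_time_append:
  "birth_time T (u @ [b]) \<omega> = T [] \<omega> + birth_time (\<lambda>u. T (u @ [b])) u \<omega>"
  by (induction u) auto

lemma birth_place_append:
  "birth_place T W (u @ [b]) \<omega> =
    W [] (T [] \<omega>) \<omega> + birth_place (\<lambda>u. T (u @ [b])) (\<lambda>u. W (u @ [b])) u \<omega>"
  by (induction u) (auto simp: add.assoc)

text \<open>The subtree of descendants of \<open>v\<close> is the branching process with lifetimes \<open>T (u @ v)\<close> and
  motions \<open>W (u @ v)\<close>.\<close>

definition avoids :: "(bool list \<Rightarrow> 'w \<Rightarrow> real) \<Rightarrow> (bool list \<Rightarrow> real \<Rightarrow> 'w \<Rightarrow> 'a::euclidean_space) \<Rightarrow>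
    'a set \<Rightarrow> bool list \<Rightarrow> real \<Rightarrow> 'a \<Rightarrow> 'w \<Rightarrow> bool" where
  "avoids T W A v t x \<omega> \<longleftrightarrow> (\<forall>u\<in>alive (\<lambda>u. T (u @ v)) t \<omega>.
    x + position (\<lambda>u. T (u @ v)) (\<lambda>u. W (u @ v)) u t \<omega> \<notin> A)"

section \<open>Independent blocks of lifetimes and motions\<close>

context dyadic_branching_brownian_motion
begin

text \<open>The index type copies that of \<open>indep_lifetimes_motions\<close>, so that disjoint
  blocks become independent sigma-algebras.\<close>

definition \<F> :: "(bool list + bool list) set \<Rightarrow> 'w measure" where
  "\<F> I = sigma (space M) (\<Union>i\<in>I. case i of
      Inl u \<Rightarrow> sets (vimage_algebra (space M) (T u) borel)
    | Inr u \<Rightarrow> sets (vimage_algebra (space M) (\<lambda>\<omega>. \<lambda>t\<in>{0..}. W u t \<omega>) (Pi\<^sub>M {0..} (\<lambda>_. borel))))"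

lemma generator_subset:
  "(\<Union>i\<in>I. case i of
      Inl u \<Rightarrow> sets (vimage_algebra (space M) (T u) borel)
    | Inr u \<Rightarrow> sets (vimage_algebra (space M) (\<lambda>\<omega>. \<lambda>t\<in>{0..}. W u t \<omega>) (Pi\<^sub>M {0..} (\<lambda>_. borel))))
    \<subseteq> events"
  using indep_lifetimes_motions unfolding indep_sets_def by (auto simp: subset_eq)

lemma space_\<F>[simp]: "space (\<F> I) = space M"
  unfolding \<F>_def by (rule space_measure_of) (use generator_subset sets.sets_into_space in blast)

lemma sets_\<F>: "sets (\<F> I) = sigma_sets (space M) (\<Union>i\<in>I. case i of
      Inl u \<Rightarrow> sets (vimage_algebra (space M) (T u) borel)
    | Inr u \<Rightarrow> sets (vimage_algebra (space M) (\<lambda>\<omega>. \<lambda>t\<in>{0..}. W u t \<omega>) (Pi\<^sub>M {0..} (\<lambda>_. borel))))"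
  unfolding \<F>_def by (rule sets_measure_of) (use generator_subset sets.sets_into_space in blast)

lemma sets_\<F>_events: "sets (\<F> I) \<subseteq> events"
  unfolding sets_\<F> by (intro sets.sigma_sets_subset generator_subset)

lemma id_\<F>[measurable]: "(\<lambda>\<omega>. \<omega>) \<in> measurable M (\<F> I)"
  using sets_\<F>_events[of I] by (auto simp: measurable_def)

text \<open>An inclusion of sigma-algebras is stated as measurability of the identity, a form that
  composes with other measurable maps.\<close>

lemma id_\<F>_mono: "I \<subseteq> J \<Longrightarrow> (\<lambda>\<omega>. \<omega>) \<in> measurable (\<F> J) (\<F> I)"
proof -
  assume "I \<subseteq> J"
  then have "sets (\<F> I) \<subseteq> sets (\<F> J)" unfolding sets_\<F> by (intro sigma_sets_mono') blast
  then show ?thesis by (auto simp: measurable_def)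
qed

lemma lifetime_\<F>: "Inl u \<in> I \<Longrightarrow> T u \<in> borel_measurable (\<F> I)"
proof -
  assume u: "Inl u \<in> I"
  have "T u -` A \<inter> space M \<in> sets (\<F> I)" if "A \<in> sets borel" for A
    unfolding sets_\<F> by (rule sigma_sets.Basic, rule UN_I[OF u]) (simp add: in_vimage_algebra that)
  then show ?thesis by (auto simp: measurable_def)
qed

lemma motion_\<F>: "Inr u \<in> I \<Longrightarrow> 0 \<le> t \<Longrightarrow> W u t \<in> borel_measurable (\<F> I)"
proof -
  assume u: "Inr u \<in> I" and t: "0 \<le> t"
  have "W u t -` A \<inter> space M \<in> sets (\<F> I)" if A: "A \<in> sets borel" for A
  proof -
    let ?N = "Pi\<^sub>M {0..} (\<lambda>_. borel :: 'a measure)"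
    have "(\<lambda>f. f t) -` A \<inter> space ?N \<in> sets ?N"
      using t A by (intro measurable_sets[OF measurable_component_singleton]) auto
    then have "(\<lambda>\<omega>. \<lambda>t\<in>{0..}. W u t \<omega>) -` ((\<lambda>f. f t) -` A \<inter> space ?N) \<inter> space M
        \<in> sets (vimage_algebra (space M) (\<lambda>\<omega>. \<lambda>t\<in>{0..}. W u t \<omega>) ?N)"
      by (rule in_vimage_algebra)
    moreover have "(\<lambda>\<omega>. \<lambda>t\<in>{0..}. W u t \<omega>) -` ((\<lambda>f. f t) -` A \<inter> space ?N) \<inter> space M = W u t -` A \<inter> space M"
      using t by (auto simp: space_PiM)
    ultimately have "W u t -` A \<inter> space M \<in> sets (vimage_algebra (space M) (\<lambda>\<omega>. \<lambda>t\<in>{0..}. W u t \<omega>) ?N)"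
      by (simp only:)
    then show ?thesis
      unfolding sets_\<F> by (intro sigma_sets.Basic UN_I[OF u]) (simp only: sum.case)
  qed
  then show ?thesis by (auto simp: measurable_def)
qed

lemma motion_\<F>_joint:
  assumes "Inr u \<in> I"
  shows "(\<lambda>p. W u (max 0 (fst p)) (snd p)) \<in> borel_measurable (borel \<Otimes>\<^sub>M \<F> I)"
proof -
  interpret standard_brownian_motion M "W u" by (rule motion_brownian)
  show ?thesis
    using assms by (intro borel_measurable_continuous_paths motion_\<F> continuous_BM) auto
qed

lemma motion_at_measurable:
  assumes u: "Inr u \<in> I" and [measurable]: "\<sigma> \<in> borel_measurable N" "\<pi> \<in> measurable N (\<F> I)"
  shows "(\<lambda>p. W u (max 0 (\<sigma> p)) (\<pi> p)) \<in> borel_measurable N"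
  using measurable_compose[OF _ motion_\<F>_joint[OF u], of "\<lambda>p. (\<sigma> p, \<pi> p)" N] by simp

text \<open>The generators are themselves sigma-algebras, hence stable under intersection, so
  grouping an independent family into disjoint blocks keeps it independent.\<close>

lemma indep_\<F>: "I \<inter> J = {} \<Longrightarrow> indep_set (sets (\<F> I)) (sets (\<F> J))"
proof -
  assume IJ: "I \<inter> J = {}"
  let ?E = "case_sum
          (\<lambda>u. sets (vimage_algebra (space M) (T u) borel))
          (\<lambda>u. sets (vimage_algebra (space M) (\<lambda>\<omega>. \<lambda>t\<in>{0..}. W u t \<omega>) (Pi\<^sub>M {0..} (\<lambda>_. borel))))"
  have "indep_sets (\<lambda>b. sigma_sets (space M) (\<Union>i\<in>case_bool I J b. ?E i)) UNIV"
  proof (rule indep_sets_collect_sigma)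
    show "indep_sets ?E (\<Union>b. case_bool I J b)"
      using indep_lifetimes_motions by (rule indep_sets_mono_index[rotated]) simp
    show "disjoint_family_on (case_bool I J) UNIV"
      using IJ by (auto simp: disjoint_family_on_def split: bool.split)
    show "Int_stable (?E i)" for i
      by (auto simp: Int_stable_def split: sum.split)
  qed
  then show ?thesis
    unfolding indep_set_def sets_\<F> by (rule indep_sets_mono_sets) (auto split: bool.split)
qed

definition descendants :: "bool list \<Rightarrow> (bool list + bool list) set" where
  "descendants v = range (\<lambda>u. Inl (u @ v)) \<union> range (\<lambda>u. Inr (u @ v))"

lemma descendants_disjoint: "descendants (False # v) \<inter> descendants (True # v) = {}"
proof -
  have False if "u @ False # v = u' @ True # v" for u u'
  proof -
    from that have "length u = length u'" using arg_cong[OF that, of length] by simp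
    with that show False by simp
  qed
  then show ?thesis unfolding descendants_def by auto
qed

lemma own_notin_descendants: "Inl v \<notin> descendants (b # v)" "Inr v \<notin> descendants (b # v)"
proof -
  have False if "v = u @ b # v" for u
    using arg_cong[OF that, of length] by simp
  then show "Inl v \<notin> descendants (b # v)" "Inr v \<notin> descendants (b # v)"
    unfolding descendants_def by auto
qed

lemma birth_time_nonneg:
  "\<omega> \<in> space M \<Longrightarrow> 0 \<le> birth_time (\<lambda>u. T (u @ v)) u \<omega>"
  by (induction u) (auto intro: add_nonneg_nonneg lifetime_nonneg)

lemma birth_time_measurable: "birth_time (\<lambda>u. T (u @ v)) u \<in> borel_measurable (\<F> (descendants v))"
proof (induction u)
  case (Cons b u)
  note [measurable] = Cons
  have [measurable]: "T (u @ v) \<in> borel_measurable (\<F> (descendants v))"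
    by (rule lifetime_\<F>) (auto simp: descendants_def)
  have "birth_time (\<lambda>u. T (u @ v)) (b # u) = (\<lambda>\<omega>. birth_time (\<lambda>u. T (u @ v)) u \<omega> + T (u @ v) \<omega>)"
    by (simp add: fun_eq_iff)
  then show ?case by simp
qed (simp add: fun_eq_iff cong: measurable_cong)

lemma birth_place_measurable:
  "birth_place (\<lambda>u. T (u @ v)) (\<lambda>u. W (u @ v)) u \<in> borel_measurable (\<F> (descendants v))"
proof (induction u)
  case (Cons b u)
  note [measurable] = Cons
  have [measurable]: "T (u @ v) \<in> borel_measurable (\<F> (descendants v))"
    by (rule lifetime_\<F>) (auto simp: descendants_def)
  have [measurable]: "(\<lambda>\<omega>. W (u @ v) (max 0 (T (u @ v) \<omega>)) \<omega>) \<in> borel_measurable (\<F> (descendants v))"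
    by (rule motion_at_measurable[where I = "descendants v"]) (simp add: descendants_def, measurable)
  have "(\<lambda>\<omega>. birth_place (\<lambda>u. T (u @ v)) (\<lambda>u. W (u @ v)) u \<omega> + W (u @ v) (max 0 (T (u @ v) \<omega>)) \<omega>)
      \<in> borel_measurable (\<F> (descendants v))"
    by measurable
  then show ?case
    by (rule subst[OF measurable_cong, rotated]) (simp add: lifetime_nonneg)
qed (simp add: fun_eq_iff cong: measurable_cong)

lemma avoids_measurable:
  assumes [measurable]: "A \<in> sets borel"
  shows "Measurable.pred ((borel \<Otimes>\<^sub>M borel) \<Otimes>\<^sub>M \<F> (descendants v))
    (\<lambda>p. avoids T W A v (fst (fst p)) (snd (fst p)) (snd p))"
proof -
  let ?N = "(borel \<Otimes>\<^sub>M borel) \<Otimes>\<^sub>M \<F> (descendants v) :: ((real \<times> 'a) \<times> 'w) measure"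
  let ?T = "\<lambda>u. T (u @ v)"
  let ?b = "\<lambda>u p. birth_time ?T u (snd p)"
  have [measurable]: "T (u @ v) \<in> borel_measurable (\<F> (descendants v))"
      "birth_time ?T u \<in> borel_measurable (\<F> (descendants v))"
      "birth_place ?T (\<lambda>u. W (u @ v)) u \<in> borel_measurable (\<F> (descendants v))" for u
    by (rule lifetime_\<F> birth_time_measurable birth_place_measurable, simp add: descendants_def)
      (rule birth_time_measurable birth_place_measurable)+
  have [measurable]: "(\<lambda>p. W (u @ v) (max 0 (fst (fst p) - ?b u p)) (snd p)) \<in> borel_measurable ?N" for u
    by (rule motion_at_measurable[where I = "descendants v"]) (simp add: descendants_def, measurable)
  \<comment> \<open>Labels form a countable type, so the quantifier preserves measurability;
    \<open>max 0\<close> changes nothing where the premise holds, since the age is then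
    nonnegative.\<close>
  have "Measurable.pred ?N (\<lambda>p. \<forall>u. ?b u p \<le> fst (fst p) \<and> fst (fst p) < ?b u p + T (u @ v) (snd p) \<longrightarrow>
      snd (fst p) + (birth_place ?T (\<lambda>u. W (u @ v)) u (snd p) +
        W (u @ v) (max 0 (fst (fst p) - ?b u p)) (snd p)) \<notin> A)"
    by measurable
  moreover have "avoids T W A v (fst (fst p)) (snd (fst p)) (snd p) \<longleftrightarrow>
      (\<forall>u. ?b u p \<le> fst (fst p) \<and> fst (fst p) < ?b u p + T (u @ v) (snd p) \<longrightarrow>
      snd (fst p) + (birth_place ?T (\<lambda>u. W (u @ v)) u (snd p) +
        W (u @ v) (max 0 (fst (fst p) - ?b u p)) (snd p)) \<notin> A)" for p
    by (auto simp: avoids_def alive_def position_def max_def)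
  ultimately show ?thesis by simp
qed

text \<open>First-branching decomposition, path by path. Lifetimes are half-open intervals, so at
  time \<open>t\<close> the root is either alive or already replaced by its children. Before that
  the subtrees are empty, because their own clocks still show a negative time.\<close>

lemma avoids_step:
  assumes \<omega>: "\<omega> \<in> space M" and t: "0 \<le> t"
  shows "avoids T W A v t x \<omega> \<longleftrightarrow>
    (if t < T v \<omega> then x + W v t \<omega> \<notin> A
     else \<forall>b. avoids T W A (b # v) (t - T v \<omega>) (x + W v (T v \<omega>) \<omega>) \<omega>)"
proof -
  let ?T = "\<lambda>u. T (u @ v)" and ?W = "\<lambda>u. W (u @ v)"
  have split: "avoids T W A v t x \<omega> \<longleftrightarrow> ([] \<in> alive ?T t \<omega> \<longrightarrow> x + position ?T ?W [] t \<omega> \<notin> A) \<and>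
      (\<forall>b u. u @ [b] \<in> alive ?T t \<omega> \<longrightarrow> x + position ?T ?W (u @ [b]) t \<omega> \<notin> A)"
    unfolding avoids_def Ball_def
    by (rule iffI, blast, intro allI impI, rename_tac u, case_tac u rule: rev_cases, simp_all)
  have root: "[] \<in> alive ?T t \<omega> \<longleftrightarrow> t < T v \<omega>" "position ?T ?W [] t \<omega> = W v t \<omega>"
    using t by (auto simp: alive_def position_def)
  have child: "u @ [b] \<in> alive ?T t \<omega> \<longleftrightarrow> u \<in> alive (\<lambda>u. T (u @ b # v)) (t - T v \<omega>) \<omega>"
    "position ?T ?W (u @ [b]) t \<omega> =
      W v (T v \<omega>) \<omega> + position (\<lambda>u. T (u @ b # v)) (\<lambda>u. W (u @ b # v)) u (t - T v \<omega>) \<omega>" for u b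
    by (auto simp: alive_def position_def birth_time_append birth_place_append algebra_simps)
  have none: "alive (\<lambda>u. T (u @ b # v)) (t - T v \<omega>) \<omega> = {}" if "t < T v \<omega>" for b
  proof -
    have "t - T v \<omega> < birth_time (\<lambda>u. T (u @ b # v)) u \<omega>" for u
      using birth_time_nonneg[OF \<omega>, of "b # v" u] that by linarith
    then show ?thesis by (auto simp: alive_def not_le)
  qed
  show ?thesis
    unfolding split root child using none by (auto simp: avoids_def add.assoc)
qed

text \<open>The label remains an argument because subtrees below different labels are different
  random objects; that the value does not depend on it is the content of
  \<open>avoid_le_avoid\<close>.\<close>

definition avoid :: "'a set \<Rightarrow> bool list \<Rightarrow> real \<Rightarrow> 'a \<Rightarrow> ennreal" where
  "avoid A v t x = (\<integral>\<^sup>+\<omega>. of_bool (avoids T W A v t x \<omega>) \<partial>M)"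

lemma of_bool_avoids_measurable:
  assumes A: "A \<in> sets borel"
    and [measurable]: "\<sigma> \<in> borel_measurable N" "\<xi> \<in> borel_measurable N" "\<pi> \<in> measurable N (\<F> (descendants v))"
  shows "(\<lambda>p. of_bool (avoids T W A v (\<sigma> p) (\<xi> p) (\<pi> p)) :: ennreal) \<in> borel_measurable N"
proof -
  have [measurable]: "Measurable.pred N (\<lambda>p. avoids T W A v (\<sigma> p) (\<xi> p) (\<pi> p))"
    using measurable_compose[OF _ avoids_measurable[OF A], of "\<lambda>p. ((\<sigma> p, \<xi> p), \<pi> p)" N] by simp
  show ?thesis unfolding of_bool_def by measurable
qed

lemma avoid_measurable:
  assumes [measurable]: "A \<in> sets borel"
  shows "(\<lambda>p. avoid A v (fst p) (snd p)) \<in> borel_measurable (borel \<Otimes>\<^sub>M borel)"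
  unfolding avoid_def
  by (intro borel_measurable_nn_integral) (simp add: case_prod_unfold of_bool_avoids_measurable)

lemma avoid_le_1: "avoid A v t x \<le> 1"
proof -
  have "avoid A v t x \<le> (\<integral>\<^sup>+\<omega>. 1 \<partial>M)" unfolding avoid_def by (intro nn_integral_mono) auto
  then show ?thesis by (simp add: emeasure_space_1)
qed

text \<open>All motions share their Gaussian one-time laws, so a single motion, \<open>W []\<close>,
  can serve in every equation.\<close>

lemma heat_motion:
  assumes [measurable]: "f \<in> borel_measurable borel"
  shows "heat M (W u) s f x = heat M (W v) s f x"
proof (cases "0 < s")
  case True
  interpret u: standard_brownian_motion M "W u" by (rule motion_brownian)
  interpret v: standard_brownian_motion M "W v" by (rule motion_brownian)
  show ?thesis using u.P_density[OF True] v.P_density[OF True] by simp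
next
  case False
  interpret u: standard_brownian_motion M "W u" by (rule motion_brownian)
  interpret v: standard_brownian_motion M "W v" by (rule motion_brownian)
  have "heat M (W z) s f x = heat M (W z) 0 f x" for z
    using False by (simp add: heat_def max_def)
  then show ?thesis by (simp add: u.P_0 v.P_0)
qed

text \<open>The two subtrees use disjoint blocks of randomness; this independence is the source of
  the quadratic term.\<close>

lemma avoid_children:
  assumes A: "A \<in> sets borel"
  shows "(\<integral>\<^sup>+\<omega>. of_bool (avoids T W A (False # v) t x \<omega>) * of_bool (avoids T W A (True # v) t x \<omega>) \<partial>M)
    = avoid A (False # v) t x * avoid A (True # v) t x"
proof -
  have m: "(\<lambda>\<omega>. of_bool (avoids T W A w t x \<omega>) :: ennreal) \<in> borel_measurable (\<F> (descendants w))" for w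
    by (rule of_bool_avoids_measurable[OF A]) measurable
  note [measurable] = m measurable_compose[OF id_\<F> m]
  have "(\<integral>\<^sup>+\<omega>. of_bool (avoids T W A (False # v) t x \<omega>) * of_bool (avoids T W A (True # v) t x \<omega>) \<partial>M)
    = (\<integral>\<^sup>+\<omega>. \<integral>\<^sup>+\<omega>'. of_bool (avoids T W A (False # v) t x \<omega>) * of_bool (avoids T W A (True # v) t x \<omega>') \<partial>M \<partial>M)"
    using nn_integral_indep_set[where F = "\<lambda>p. fst p * of_bool (avoids T W A (True # v) t x (snd p))" and S = borel
        and ?N1.0 = "\<F> (descendants (False # v))" and ?N2.0 = "\<F> (descendants (True # v))"
        and X = "\<lambda>\<omega>. of_bool (avoids T W A (False # v) t x \<omega>)"]
      indep_\<F>[OF descendants_disjoint[of v]] by simp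
  then show ?thesis by (simp add: avoid_def nn_integral_cmult nn_integral_multc)
qed

text \<open>Independence is used three times: to freeze the lifetime of \<open>v\<close>, then its
  motion, and finally to separate the two subtrees.\<close>

lemma avoid_renewal:
  assumes A: "A \<in> sets borel" and t: "0 \<le> t" and \<beta>: "0 < \<beta>"
  shows "avoid A v t x = duhamel M (W []) \<beta> t (\<lambda>y. of_bool (y \<notin> A))
    (\<lambda>u y. avoid A (False # v) u y * avoid A (True # v) u y) x"
proof -
  note [measurable] = A
  have ind[measurable]: "(\<lambda>y. of_bool (y \<notin> A) :: ennreal) \<in> borel_measurable borel"
    unfolding of_bool_def by measurable
  define c where "c b s y \<omega> = (of_bool (avoids T W A (b # v) (t - s) (x + y) \<omega>) :: ennreal)" for b s y \<omega>
  define F where "F p = (if t < fst p then of_bool (x + W v (max 0 t) (snd p) \<notin> A)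
      else c False (fst p) (W v (max 0 (fst p)) (snd p)) (snd p) *
        c True (fst p) (W v (max 0 (fst p)) (snd p)) (snd p))" for p :: "real \<times> 'w"
  define K where "K = descendants (False # v) \<union> descendants (True # v)"
  define J where "J = insert (Inr v) K"
  have K: "descendants (b # v) \<subseteq> K" for b by (cases b) (auto simp: K_def)
  have [measurable]: "F \<in> borel_measurable (borel \<Otimes>\<^sub>M \<F> J)"
  proof -
    have [measurable]: "(\<lambda>p. W v (max 0 (fst p)) (snd p)) \<in> borel_measurable (borel \<Otimes>\<^sub>M \<F> J)"
      by (rule motion_\<F>_joint) (simp add: J_def)
    have [measurable]: "W v (max 0 t) \<in> borel_measurable (\<F> J)" by (rule motion_\<F>) (auto simp: J_def)
    have [measurable]: "(\<lambda>\<omega>. \<omega>) \<in> measurable (\<F> J) (\<F> (descendants (b # v)))" for b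
      using K[of b] by (intro id_\<F>_mono) (auto simp: J_def)
    have [measurable]: "(\<lambda>p. snd p) \<in> measurable (borel \<Otimes>\<^sub>M \<F> J) (\<F> (descendants (b # v)))" for b
      by (rule measurable_compose[OF measurable_snd]) measurable
    have [measurable]: "(\<lambda>p. c b (fst p) (W v (max 0 (fst p)) (snd p)) (snd p)) \<in> borel_measurable (borel \<Otimes>\<^sub>M \<F> J)" for b
      unfolding c_def by (rule of_bool_avoids_measurable[OF A]) measurable
    have [measurable]: "(\<lambda>p. of_bool (x + W v (max 0 t) (snd p) \<notin> A) :: ennreal) \<in> borel_measurable (borel \<Otimes>\<^sub>M \<F> J)"
      by (rule measurable_compose[OF _ ind]) measurable
    show ?thesis unfolding F_def by measurable
  qed
  have "(\<lambda>p. (fst p, snd p)) \<in> measurable (borel \<Otimes>\<^sub>M M) (borel \<Otimes>\<^sub>M \<F> J)"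
    by (intro measurable_Pair measurable_fst measurable_compose[OF measurable_snd id_\<F>])
  from measurable_compose[OF this \<open>F \<in> borel_measurable (borel \<Otimes>\<^sub>M \<F> J)\<close>]
  have F_M[measurable]: "F \<in> borel_measurable (borel \<Otimes>\<^sub>M M)" by simp
  define g where "g s = (\<integral>\<^sup>+\<omega>. F (s, \<omega>) \<partial>M)" for s
  have g[measurable]: "g \<in> borel_measurable borel"
    unfolding g_def by measurable
  have "avoid A v t x = (\<integral>\<^sup>+\<omega>. F (T v \<omega>, \<omega>) \<partial>M)"
    unfolding avoid_def
  proof (rule nn_integral_cong)
    fix \<omega> assume \<omega>: "\<omega> \<in> space M"
    show "of_bool (avoids T W A v t x \<omega>) = F (T v \<omega>, \<omega>)"
      unfolding avoids_step[OF \<omega> t] F_def c_def using t lifetime_nonneg[OF \<omega>, of v]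
      by (auto simp: all_bool_eq)
  qed
  also have "\<dots> = (\<integral>\<^sup>+\<omega>. g (T v \<omega>) \<partial>M)"
    unfolding g_def
  proof (rule nn_integral_indep_set[where S = borel and ?N1.0 = "\<F> {Inl v}" and ?N2.0 = "\<F> J"])
    show "T v \<in> borel_measurable (\<F> {Inl v})" by (rule lifetime_\<F>) simp
    show "indep_set (sets (\<F> {Inl v})) (sets (\<F> J))"
      using own_notin_descendants by (intro indep_\<F>) (auto simp: J_def K_def)
  qed measurable
  also have "\<dots> = (\<integral>\<^sup>+s. ennreal (exponential_density \<beta> s) * g s \<partial>lborel)"
    by (rule distributed_nn_integral[OF lifetime_exponential, symmetric]) measurable
  also have "\<dots> = (\<integral>\<^sup>+s. ennreal (\<beta> * exp (- \<beta> * s)) * indicator {t<..} s * heat M (W []) t (\<lambda>y. of_bool (y \<notin> A)) x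
      + ennreal (\<beta> * exp (- \<beta> * s)) * heat M (W []) s (\<lambda>y. avoid A (False # v) (t - s) y * avoid A (True # v) (t - s) y) x
        * indicator {0..t} s \<partial>lborel)"
  proof (rule nn_integral_cong)
    fix s :: real
    consider "s < 0" | "t < s" | "0 \<le> s" "s \<le> t" by linarith
    then show "ennreal (exponential_density \<beta> s) * g s = 
      ennreal (\<beta> * exp (- \<beta> * s)) * indicator {t<..} s * heat M (W []) t (\<lambda>y. of_bool (y \<notin> A)) x
      + ennreal (\<beta> * exp (- \<beta> * s)) * heat M (W []) s (\<lambda>y. avoid A (False # v) (t - s) y * avoid A (True # v) (t - s) y) x
        * indicator {0..t} s"
    proof cases
      case 1
      then show ?thesis using t by (simp add: exponential_density_def)
    next
      case 2
      then have "g s = heat M (W v) t (\<lambda>y. of_bool (y \<notin> A)) x"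
        unfolding g_def F_def heat_def by simp
      then show ?thesis
        using 2 t heat_motion[OF ind, of v t x "[]"] by (simp add: exponential_density_def mult_ac)
    next
      case 3
      have m: "(\<lambda>p. c False s (fst p) (snd p) * c True s (fst p) (snd p)) \<in> borel_measurable (borel \<Otimes>\<^sub>M \<F> K)"
      proof -
        have "(\<lambda>\<omega>. \<omega>) \<in> measurable (\<F> K) (\<F> (descendants (b # v)))" for b
          using K[of b] by (intro id_\<F>_mono) auto
        then have [measurable]: "(\<lambda>p. snd p) \<in> measurable (borel \<Otimes>\<^sub>M \<F> K) (\<F> (descendants (b # v)))" for b
          by (rule measurable_compose[OF measurable_snd])
        have [measurable]: "(\<lambda>p. c b s (fst p) (snd p)) \<in> borel_measurable (borel \<Otimes>\<^sub>M \<F> K)" for b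
          unfolding c_def by (rule of_bool_avoids_measurable[OF A]) measurable
        show ?thesis by measurable
      qed
      have "g s = (\<integral>\<^sup>+\<omega>. c False s (W v (max 0 s) \<omega>) \<omega> * c True s (W v (max 0 s) \<omega>) \<omega> \<partial>M)"
        unfolding g_def F_def using 3 by simp
      also have "\<dots> = (\<integral>\<^sup>+\<omega>. \<integral>\<^sup>+\<omega>'. c False s (W v (max 0 s) \<omega>) \<omega>' * c True s (W v (max 0 s) \<omega>) \<omega>' \<partial>M \<partial>M)"
      proof (rule nn_integral_indep_set[where F = "\<lambda>p. c False s (fst p) (snd p) * c True s (fst p) (snd p)"
            and S = borel and ?N1.0 = "\<F> {Inr v}" and ?N2.0 = "\<F> K", simplified])
        show "W v (max 0 s) \<in> borel_measurable (\<F> {Inr v})" by (rule motion_\<F>) auto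
        show "(\<lambda>p. c False s (fst p) (snd p) * c True s (fst p) (snd p)) \<in> borel_measurable (borel \<Otimes>\<^sub>M \<F> K)"
          by (rule m)
        show "indep_set (sets (\<F> {Inr v})) (sets (\<F> K))"
          using own_notin_descendants by (intro indep_\<F>) (auto simp: K_def)
      qed
      also have "\<dots> = heat M (W v) s (\<lambda>y. avoid A (False # v) (t - s) y * avoid A (True # v) (t - s) y) x"
        unfolding heat_def c_def by (simp add: avoid_children[OF A])
      also have "\<dots> = heat M (W []) s (\<lambda>y. avoid A (False # v) (t - s) y * avoid A (True # v) (t - s) y) x"
      proof -
        have [measurable]: "avoid A w (t - s) \<in> borel_measurable borel" for w
          using measurable_compose[OF _ avoid_measurable[OF A], of "\<lambda>y. (t - s, y)" borel] by simp
        show ?thesis by (rule heat_motion) measurable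
      qed
      finally show ?thesis using 3 by (simp add: exponential_density_def mult_ac)
    qed
  qed
  also have "\<dots> = duhamel M (W []) \<beta> t (\<lambda>y. of_bool (y \<notin> A))
    (\<lambda>u y. avoid A (False # v) u y * avoid A (True # v) u y) x"
  proof -
    interpret standard_brownian_motion M "W []" by (rule motion_brownian)
    interpret branching_heat M "W []" \<beta> using \<beta> by unfold_locales
    have [measurable]: "(\<lambda>p. avoid A w (fst p) (snd p)) \<in> borel_measurable (borel \<Otimes>\<^sub>M borel)" for w
      by (rule avoid_measurable[OF A])
    have [measurable]: "(\<lambda>s. heat M (W []) s (\<lambda>y. avoid A (False # v) (t - s) y * avoid A (True # v) (t - s) y) x)
        \<in> borel_measurable lborel"
      by (rule P_flow_measurable[where g = "\<lambda>u y. avoid A (False # v) u y * avoid A (True # v) u y"]) measurable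
    show ?thesis
      unfolding duhamel_def
      by (subst nn_integral_add, measurable) (subst nn_integral_multc, measurable, subst nn_integral_exp_Ioi[OF \<beta>], rule refl)
  qed
  finally show ?thesis .
qed

end

section \<open>The KPP equation\<close>

lemma ennreal_le_add_diff: "x \<le> y + (x - y)" for x y :: ennreal
  by (cases "y \<le> x") (auto simp: add_diff_inverse_ennreal add_increasing2)

text \<open>Truncated form of ab - cd = (a - c)b + c(b - d), with the factors b and c bounded by
  1.\<close>

lemma ennreal_mult_le_add_diff:
  fixes a b c d :: ennreal
  assumes "b \<le> 1" "c \<le> 1"
  shows "a * b \<le> c * d + ((a - c) + (b - d))"
proof -
  have "a * b \<le> (c + (a - c)) * b" by (intro mult_right_mono ennreal_le_add_diff) simp
  also have "\<dots> \<le> c * (d + (b - d)) + (a - c) * b"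
    unfolding distrib_right by (intro add_right_mono mult_left_mono ennreal_le_add_diff) simp
  also have "\<dots> \<le> c * d + (1 * (b - d)) + (a - c) * 1"
    unfolding distrib_left using assms
    by (intro add_mono mult_left_mono mult_right_mono order_refl) simp_all
  finally show ?thesis by (simp add: add_ac)
qed

text \<open>The renewal equation for one pair of labels involves the labels of the children, so it
  does not close on that pair. The contraction is therefore run on the family of all label pairs at
  once; exchanging the two labels then gives equality.\<close>

lemma (in dyadic_branching_brownian_motion) avoid_le_avoid:
  assumes A: "A \<in> sets borel" and \<beta>: "0 < \<beta>" and t: "0 \<le> t"
  shows "avoid A v t x \<le> avoid A v' t x"
proof -
  interpret standard_brownian_motion M "W []" by (rule motion_brownian)
  interpret branching_heat M "W []" \<beta> using \<beta> by unfold_locales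
  note [measurable] = A avoid_measurable[OF A]
  have [measurable]: "(\<lambda>y. of_bool (y \<notin> A) :: ennreal) \<in> borel_measurable borel"
    unfolding of_bool_def by measurable
  define D where "D i u y = avoid A (fst i) u y - avoid A (snd i) u y" for i u y
  have "D (v, v') t x = 0"
  proof (rule Q_contraction[where D = D])
    show "D i h x \<le> 1" for i h x
      using avoid_le_1[of A "fst i" h x] neq_top_trans[OF ennreal_one_neq_top avoid_le_1[of A "fst i" h x]]
      unfolding D_def by (auto simp: ennreal_minus_le_iff intro: order_trans add_increasing)
    show "\<exists>j k. \<forall>h x. 0 \<le> h \<longrightarrow> h \<le> t \<longrightarrow> D i h x \<le> Q h (\<lambda>_. 0) (\<lambda>u y. D j u y + D k u y) x" for i
    proof (intro exI allI impI)
      fix h x assume h: "0 \<le> h" "h \<le> t"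
      let ?a = "\<lambda>b u y. avoid A (b # fst i) u y" and ?c = "\<lambda>b u y. avoid A (b # snd i) u y"
      let ?D = "\<lambda>b. D (b # fst i, b # snd i)"
      have "avoid A (fst i) h x \<le> Q h (\<lambda>y. of_bool (y \<notin> A) + 0)
          (\<lambda>u y. ?c False u y * ?c True u y + (?D False u y + ?D True u y)) x"
        unfolding avoid_renewal[OF A h(1) \<beta>] D_def
        by (intro Q_mono) (auto intro!: ennreal_mult_le_add_diff avoid_le_1)
      also have "\<dots> = Q h (\<lambda>y. of_bool (y \<notin> A)) (\<lambda>u y. ?c False u y * ?c True u y) x
          + Q h (\<lambda>_. 0) (\<lambda>u y. ?D False u y + ?D True u y) x"
        unfolding D_def by (rule Q_add) measurable
      also have "\<dots> = avoid A (snd i) h x + Q h (\<lambda>_. 0) (\<lambda>u y. ?D False u y + ?D True u y) x"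
        unfolding avoid_renewal[OF A h(1) \<beta>, of "snd i"] ..
      finally show "D i h x \<le> Q h (\<lambda>_. 0) (\<lambda>u y. ?D False u y + ?D True u y) x"
        unfolding D_def[of i] using neq_top_trans[OF ennreal_one_neq_top avoid_le_1[of A "fst i" h x]]
        by (auto simp: ennreal_minus_le_iff)
    qed
  qed (use t in auto)
  moreover have "avoid A v t x \<noteq> top" by (rule neq_top_trans[OF ennreal_one_neq_top avoid_le_1])
  ultimately show ?thesis by (simp add: D_def ennreal_minus_eq_0)
qed

text \<open>\<open>w\<close> is the probability that no particle is in the ball at time \<open>t\<close> if the process starts at
  \<open>x\<close>; \<open>v = 1 - w\<close> solves the KPP equation \<open>v\<^sub>t = \<Delta>v/2 + \<beta>v(1 - v)\<close>.\<close>

locale kpp = branching_heat M W \<beta>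
  for M :: "'w measure" and W :: "real \<Rightarrow> 'w \<Rightarrow> 'a::euclidean_space" and \<beta> :: real +
  fixes r :: real and w :: "real \<Rightarrow> 'a \<Rightarrow> ennreal"
  assumes r_pos: "0 < r"
    and w_measurable[measurable]: "(\<lambda>p. w (fst p) (snd p)) \<in> borel_measurable (borel \<Otimes>\<^sub>M borel)"
    and w_le_1: "w t x \<le> 1"
    and w_eq: "0 \<le> t \<Longrightarrow> w t x = duhamel M W \<beta> t (\<lambda>y. of_bool (y \<notin> ball 0 r)) (\<lambda>u y. w u y * w u y) x"
begin

definition v :: "real \<Rightarrow> 'a \<Rightarrow> ennreal" where "v t x = 1 - w t x"

lemma v_measurable[measurable]: "(\<lambda>p. v (fst p) (snd p)) \<in> borel_measurable (borel \<Otimes>\<^sub>M borel)"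
  unfolding v_def by measurable

lemma w_v_measurable[measurable]: "w t \<in> borel_measurable borel" "v t \<in> borel_measurable borel"
  by (auto intro: section_measurable)

lemma w_shift_measurable[measurable]: "(\<lambda>p. w (t + fst p) (snd p)) \<in> borel_measurable (borel \<Otimes>\<^sub>M borel)"
  using measurable_compose[OF _ w_measurable, of "\<lambda>p. (t + fst p, snd p)" "borel \<Otimes>\<^sub>M borel"] by simp

lemma v_shift_measurable[measurable]: "(\<lambda>p. v (t + fst p) (snd p)) \<in> borel_measurable (borel \<Otimes>\<^sub>M borel)"
  unfolding v_def by measurable

lemma w_v_real:
  obtains a where "0 \<le> a" "a \<le> 1" "w t x = ennreal (1 - a)" "v t x = ennreal a"
proof -
  have "w t x \<noteq> top" by (rule neq_top_trans[OF ennreal_one_neq_top w_le_1])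
  then obtain b where b: "0 \<le> b" "w t x = ennreal b" by (cases "w t x") auto
  then have "b \<le> 1" using w_le_1[of t x] by simp
  with b show ?thesis by (intro that[of "1 - b"]) (auto simp: v_def ennreal_minus[of b 1, simplified])
qed

lemma w_plus_v: "w t x + v t x = 1"
  unfolding v_def using w_le_1 by (simp add: add_diff_inverse_ennreal)

lemma v_le_1: "v t x \<le> 1"
  using w_v_real[of t x] by (metis ennreal_le_1)

lemma ball_indicator_measurable[measurable]: "(\<lambda>y. of_bool (y \<notin> ball (0::'a) r) :: ennreal) \<in> borel_measurable borel"
proof -
  have [measurable]: "ball 0 r \<in> sets (borel :: 'a measure)" by simp
  show ?thesis unfolding of_bool_def by measurable
qed

lemma w_0: "w 0 x = of_bool (x \<notin> ball 0 r)"
  using w_eq[of 0 x] by (simp add: Q_0)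

lemma v_0: "v 0 x = indicator (ball 0 r) x"
  unfolding v_def w_0 by (simp add: indicator_def)

lemma w_restart:
  assumes "0 \<le> t" "0 \<le> h"
  shows "w (t + h) x = Q h (w t) (\<lambda>u y. w (t + u) y * w (t + u) y) x"
proof -
  have "Q t (\<lambda>y. of_bool (y \<notin> ball 0 r)) (\<lambda>u y. w u y * w u y) = w t"
    using w_eq[OF assms(1)] by (simp add: fun_eq_iff)
  then show ?thesis
    using assms w_eq[of "t + h" x] Q_Q[OF assms(1,2), of "\<lambda>y. of_bool (y \<notin> ball 0 r)" "\<lambda>u y. w u y * w u y" x]
    by simp
qed

text \<open>\<open>Q_one\<close> minus \<open>w_restart\<close>, using 1 - w^2 = v(1 + w). The
  identity is first proved as a sum and cancelled only at the end, because subtraction in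
  \<open>ennreal\<close> is truncated.\<close>

lemma v_restart:
  assumes "0 \<le> t" "0 \<le> h"
  shows "v (t + h) x = Q h (v t) (\<lambda>u y. v (t + u) y * (1 + w (t + u) y)) x"
proof -
  have "w u y * w u y + v u y * (1 + w u y) = 1" for u y
  proof -
    have "w u y * w u y + v u y * (1 + w u y) = w u y * (w u y + v u y) + v u y"
      by (simp add: distrib_left distrib_right algebra_simps)
    then show ?thesis by (simp add: w_plus_v)
  qed
  then have sum: "w (t + h) x + Q h (v t) (\<lambda>u y. v (t + u) y * (1 + w (t + u) y)) x = 1"
    using Q_one[OF assms(2), of x] unfolding w_restart[OF assms]
    by (subst Q_add[symmetric]) (simp_all add: w_plus_v)
  have "w (t + h) x \<noteq> top" by (rule neq_top_trans[OF ennreal_one_neq_top w_le_1])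
  from ennreal_add_diff_cancel_left[OF this] show ?thesis
    unfolding v_def[of "t + h" x] by (rule subst[OF sum])
qed

section \<open>Comparison with linear equations\<close>

lemma linear_measurable:
  assumes [measurable]: "f \<in> borel_measurable borel"
  shows "(\<lambda>p. ennreal (exp (c * fst p)) * P (fst p) f (snd p)) \<in> borel_measurable (borel \<Otimes>\<^sub>M borel)"
proof -
  have [measurable]: "(\<lambda>p. P (fst p) f (snd p)) \<in> borel_measurable (borel \<Otimes>\<^sub>M borel)"
    by (rule P_measurable) measurable
  show ?thesis by measurable
qed

text \<open>First-moment bound: \<open>1 + w \<le> 2\<close>, and for \<kappa> = 2 the linear
  solution is the expected number of particles in the ball.\<close>

lemma v_le_linear:
  assumes "0 \<le> t"
  shows "v t x \<le> ennreal (exp (\<beta> * t)) * P t (indicator (ball 0 r)) x"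
proof -
  have f[measurable]: "indicator (ball (0::'a) r) \<in> borel_measurable borel"
    by (intro borel_measurable_indicator) simp
  define m where "m u y = ennreal (exp ((2 - 1) * \<beta> * u)) * P u (indicator (ball 0 r)) y" for u and y :: 'a
  have [measurable]: "(\<lambda>p. m (fst p) (snd p)) \<in> borel_measurable (borel \<Otimes>\<^sub>M borel)"
    unfolding m_def by (rule linear_measurable[OF f])
  have v0: "v 0 = indicator (ball 0 r)" by (simp add: fun_eq_iff v_0)
  have "v t x \<le> m t x"
  proof (rule Q_comparison[where X = v and Y = m and H = t and f = "indicator (ball 0 r)"
      and f' = "\<lambda>u y. v u y * (1 + w u y)" and g = "\<lambda>u y. 2 * m u y"])
    show "v h x \<le> Q h (indicator (ball 0 r)) (\<lambda>u y. v u y * (1 + w u y)) x" if "0 \<le> h" for h x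
      using v_restart[of 0 h x] that by (simp add: v0)
    show "Q h (indicator (ball 0 r)) (\<lambda>u y. 2 * m u y) x \<le> m h x" if "0 \<le> h" for h x
      using Q_linear[OF that _ f, of 2 x] unfolding m_def by simp
    show "v u y * (1 + w u y) \<le> 2 * m u y + 2 * (v u y - m u y)" for u y
    proof -
      have "v u y * (1 + w u y) \<le> v u y * 2"
        using add_left_mono[OF w_le_1[of u y], of 1] by (intro mult_left_mono) simp_all
      also have "\<dots> \<le> 2 * (m u y + (v u y - m u y))"
        unfolding mult.commute[of _ 2] by (intro mult_left_mono ennreal_le_add_diff) simp
      finally show ?thesis by (simp add: distrib_left)
    qed
  qed (use assms v_le_1 in auto)
  then show ?thesis by (simp add: m_def)
qed

text \<open>While the linear solution m stays below 2 - \<kappa>, one has \<kappa>m \<le> m(2 - m),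
  so m is a subsolution of the KPP equation.\<close>

lemma v_ge_linear:
  assumes t: "0 \<le> t" and h: "0 \<le> h" and \<kappa>: "1 \<le> \<kappa>" "\<kappa> \<le> 2" and f[measurable]: "f \<in> borel_measurable borel"
    and fv: "\<And>y. f y \<le> v t y"
    and small: "\<And>u y. 0 \<le> u \<Longrightarrow> u \<le> h \<Longrightarrow> ennreal (exp ((\<kappa> - 1) * \<beta> * u)) * P u f y \<le> ennreal (2 - \<kappa>)"
  shows "ennreal (exp ((\<kappa> - 1) * \<beta> * h)) * P h f x \<le> v (t + h) x"
proof -
  define m where "m u y = ennreal (exp ((\<kappa> - 1) * \<beta> * u)) * P u f y" for u y
  have [measurable]: "(\<lambda>p. m (fst p) (snd p)) \<in> borel_measurable (borel \<Otimes>\<^sub>M borel)"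
    unfolding m_def by (rule linear_measurable[OF f])
  have "m h x \<le> v (t + h) x"
  proof (rule Q_comparison[where X = m and Y = "\<lambda>u. v (t + u)" and H = h and f = f and f' = "\<lambda>u y. ennreal \<kappa> * m u y"
      and g = "\<lambda>u y. v (t + u) y * (1 + w (t + u) y)"])
    show "m u y \<le> 1" if "0 \<le> u" "u \<le> h" for u y
      using that order_trans[OF small[OF that, of y], of 1] \<kappa> unfolding m_def[symmetric]
      by (simp add: ennreal_le_1)
    show "m u y \<le> Q u f (\<lambda>u y. ennreal \<kappa> * m u y) y" if "0 \<le> u" "u \<le> h" for u y
      using Q_linear[OF that(1) _ f, of \<kappa> y] \<kappa> unfolding m_def by simp
    show "Q u f (\<lambda>u y. v (t + u) y * (1 + w (t + u) y)) y \<le> v (t + u) y" if "0 \<le> u" for u y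
      unfolding v_restart[OF t that] by (rule Q_mono[OF fv]) simp
    show "ennreal \<kappa> * m u y \<le> v (t + u) y * (1 + w (t + u) y) + 2 * (m u y - v (t + u) y)"
      if "0 \<le> u" "u \<le> h" for u y
    proof -
      obtain a where a: "0 \<le> a" "a \<le> 1" "w (t + u) y = ennreal (1 - a)" "v (t + u) y = ennreal a"
        by (rule w_v_real)
      have mu: "m u y \<le> ennreal (2 - \<kappa>)" using small[OF that] by (simp add: m_def)
      then have "m u y \<noteq> top" by (auto simp: top_unique)
      then obtain b where b: "0 \<le> b" "m u y = ennreal b" by (cases "m u y") auto
      with mu \<kappa> have b2: "b \<le> 2 - \<kappa>" by simp
      have "\<kappa> * b \<le> (2 - b) * b" using b b2 by (intro mult_right_mono) auto
      \<comment> \<open>Here a is the value of \<open>v\<close> and b that of \<open>m\<close>. The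
        source \<open>v (1 + w)\<close> equals a(2 - a), whose slope on [0, 1] is at most 2.\<close>
      also have "\<dots> \<le> a * (2 - a) + 2 * max 0 (b - a)"
      proof (cases "a \<le> b")
        case True
        have "(2 - b) * b = a * (2 - a) + (b - a) * (2 - (a + b))" by (simp add: algebra_simps)
        also have "\<dots> \<le> a * (2 - a) + (b - a) * 2" using True a b by (intro add_left_mono mult_left_mono) auto
        finally show ?thesis using True by (simp add: max_def)
      next
        case False
        have "0 \<le> (a - b) * (2 - (a + b))" using False a by (intro mult_nonneg_nonneg) auto
        then have "(2 - b) * b \<le> a * (2 - a)" by (simp add: algebra_simps)
        then show ?thesis by (simp add: max_def)
      qed
      finally have *: "\<kappa> * b \<le> a * (2 - a) + 2 * max 0 (b - a)" .
      have "ennreal b - ennreal a = ennreal (max 0 (b - a))"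
        using a by (simp add: ennreal_minus max_def ennreal_neg)
      moreover have "1 + ennreal (1 - a) = ennreal (2 - a)"
        using a by (simp add: ennreal_plus[symmetric] del: ennreal_plus flip: ennreal_1)
      moreover have "ennreal (a * (2 - a) + 2 * max 0 (b - a)) = ennreal a * ennreal (2 - a) + 2 * ennreal (max 0 (b - a))"
        using a by (simp add: ennreal_plus ennreal_mult)
      moreover have "ennreal \<kappa> * ennreal b \<le> ennreal (a * (2 - a) + 2 * max 0 (b - a))"
        using * \<kappa> b by (simp add: ennreal_mult[symmetric] ennreal_leI)
      ultimately show ?thesis using a b by simp
    qed
  qed (use h in auto)
  then show ?thesis by (simp add: m_def)
qed

text \<open>The \<open>max\<close> in \<open>le\<close> covers two regimes: where \<open>w\<close>
  is at most \<kappa>, the square is at most \<kappa>w; where the linear solution is at least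
  1/\<kappa>, the right-hand side is at least 1.\<close>

lemma w_le_linear:
  assumes t: "0 \<le> t" and h: "0 \<le> h" and \<kappa>: "0 < \<kappa>" "\<kappa> \<le> 2" and f[measurable]: "f \<in> borel_measurable borel"
    and wf: "\<And>y. w t y \<le> f y"
    and le: "\<And>u y. 0 \<le> u \<Longrightarrow> w (t + u) y * w (t + u) y \<le>
      ennreal \<kappa> * max (w (t + u) y) (ennreal (exp ((\<kappa> - 1) * \<beta> * u)) * P u f y)"
  shows "w (t + h) x \<le> ennreal (exp ((\<kappa> - 1) * \<beta> * h)) * P h f x"
proof -
  define m where "m u y = ennreal (exp ((\<kappa> - 1) * \<beta> * u)) * P u f y" for u y
  have [measurable]: "(\<lambda>p. m (fst p) (snd p)) \<in> borel_measurable (borel \<Otimes>\<^sub>M borel)"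
    unfolding m_def by (rule linear_measurable[OF f])
  have "w (t + h) x \<le> m h x"
  proof (rule Q_comparison[where X = "\<lambda>u. w (t + u)" and Y = m and H = h and f = f and f' = "\<lambda>u y. w (t + u) y * w (t + u) y"
      and g = "\<lambda>u y. ennreal \<kappa> * m u y"])
    show "w (t + u) y \<le> Q u f (\<lambda>u y. w (t + u) y * w (t + u) y) y" if "0 \<le> u" for u y
      unfolding w_restart[OF t that] by (rule Q_mono[OF wf]) simp
    show "Q u f (\<lambda>u y. ennreal \<kappa> * m u y) y \<le> m u y" if "0 \<le> u" for u y
      using Q_linear[OF that _ f, of \<kappa> y] \<kappa> unfolding m_def by simp
    show "w (t + u) y * w (t + u) y \<le> ennreal \<kappa> * m u y + 2 * (w (t + u) y - m u y)" if "0 \<le> u" for u y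
    proof -
      have "max (w (t + u) y) (m u y) = m u y + (w (t + u) y - m u y)"
        by (cases "m u y \<le> w (t + u) y")
          (auto simp: max_def diff_add_cancel_ennreal add.commute diff_eq_0_ennreal
            add_diff_inverse_ennreal diff_eq_0_iff_ennreal intro!: antisym)
      moreover have "ennreal \<kappa> \<le> 2" using \<kappa> by (metis ennreal_leI ennreal_numeral)
      ultimately show ?thesis
        using le[OF that, of y] unfolding m_def[symmetric]
        by (auto simp: distrib_left intro!: mult_right_mono add_left_mono elim!: order_trans)
    qed
  qed (use h w_le_1 in auto)
  then show ?thesis by (simp add: m_def)
qed

end

section \<open>Spreading\<close>

context branching_heat
begin

lemma Q_le:
  assumes h: "0 \<le> h" and "\<And>y. f y \<le> ennreal a" "\<And>s. 0 \<le> s \<Longrightarrow> s \<le> h \<Longrightarrow> P s (g (h - s)) x \<le> ennreal b" and "0 \<le> a" "0 \<le> b"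
  shows "Q h f g x \<le> ennreal (exp (- \<beta> * h) * a + b)"
proof -
  have "Q h f g x \<le> ennreal (exp (- \<beta> * h)) * ennreal a +
      (\<integral>\<^sup>+s\<in>{0..h}. ennreal (\<beta> * exp (- \<beta> * s)) * ennreal b \<partial>lborel)"
    unfolding duhamel_def
  proof (intro add_mono mult_left_mono nn_integral_mono)
    show "P h f x \<le> ennreal a" using P_mono[of f "\<lambda>_. ennreal a" h x] assms(2) by (simp add: P_const)
    show "ennreal (\<beta> * exp (- \<beta> * s)) * P s (g (h - s)) x * indicator {0..h} s
      \<le> ennreal (\<beta> * exp (- \<beta> * s)) * ennreal b * indicator {0..h} s" for s
      using assms(3)[of s] by (auto split: split_indicator intro!: mult_left_mono)
  qed simp
  also have "\<dots> = ennreal (exp (- \<beta> * h) * a + (1 - exp (- \<beta> * h)) * b)"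
    using h \<beta>_pos assms unfolding nn_integral_branching[OF h]
    by (simp add: ennreal_mult[symmetric] ennreal_plus[symmetric] del: ennreal_plus)
  also have "\<dots> \<le> ennreal (exp (- \<beta> * h) * a + b)"
    using assms by (intro ennreal_leI add_left_mono mult_left_le_one_le) (auto simp: \<beta>_pos less_imp_le)
  finally show ?thesis .
qed

lemma P_exp_shift:
  "0 \<le> s \<Longrightarrow> P s (\<lambda>y. ennreal (exp (c + v \<bullet> y))) x = ennreal (exp (c + (norm v)\<^sup>2 * s / 2 + v \<bullet> x))"
proof -
  assume s: "0 \<le> s"
  have "P s (\<lambda>y. ennreal (exp (c + v \<bullet> y))) x = P s (\<lambda>y. ennreal (exp c) * ennreal (exp (v \<bullet> y))) x"
    by (simp add: exp_add ennreal_mult)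
  also have "\<dots> = ennreal (exp c) * P s (\<lambda>y. ennreal (exp (v \<bullet> y))) x"
    by (rule P_cmult) measurable
  finally show ?thesis by (simp add: P_exp[OF s] ennreal_mult[symmetric] exp_add mult.assoc)
qed

text \<open>If the norm exceeds \<open>R\<close>, some coordinate exceeds \<open>R / DIM('a)\<close>
  in absolute value; then exponential Markov at unit rate for both signs. This is crude, but it is
  applied with bounded \<open>s\<close> and growing \<open>R\<close>.\<close>

lemma P_tail:
  assumes s: "0 \<le> s"
  shows "P s (indicator {z. R < norm (z - x)}) x \<le> ennreal (2 * real DIM('a) * exp (s / 2 - R / real DIM('a)))"
proof -
  let ?d = "real DIM('a)"
  let ?f = "\<lambda>b y. ennreal (exp (- (b \<bullet> x) - R / ?d + b \<bullet> y)) + ennreal (exp ((b \<bullet> x) - R / ?d + (- b) \<bullet> y))"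
  have "indicator {z. R < norm (z - x)} y \<le> (\<Sum>b\<in>Basis. ?f b y)" for y :: 'a
  proof (cases "R < norm (y - x)")
    case True
    have "\<exists>b\<in>Basis. R / ?d < \<bar>(y - x) \<bullet> b\<bar>"
    proof (rule ccontr)
      assume "\<not> (\<exists>b\<in>Basis. R / ?d < \<bar>(y - x) \<bullet> b\<bar>)"
      then have "(\<Sum>b\<in>Basis. \<bar>(y - x) \<bullet> b\<bar>) \<le> ?d * (R / ?d)"
        by (intro sum_bounded_above) (auto simp: not_less)
      then show False using norm_le_l1[of "y - x"] True by simp
    qed
    then obtain b where b: "b \<in> Basis" "R / ?d < \<bar>(y - x) \<bullet> b\<bar>" by auto
    have "(1::ennreal) \<le> ?f b y"
    proof (cases "0 \<le> (y - x) \<bullet> b")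
      case True
      then have "1 \<le> exp (- (b \<bullet> x) - R / ?d + b \<bullet> y)"
        using b(2) by (simp add: inner_diff_right inner_commute[of _ b])
      then show ?thesis by (intro add_increasing2) (simp_all flip: ennreal_1)
    next
      case False
      then have "1 \<le> exp ((b \<bullet> x) - R / ?d + (- b) \<bullet> y)"
        using b(2) by (simp add: inner_diff_right inner_commute[of _ b])
      then show ?thesis by (intro add_increasing) (simp_all flip: ennreal_1)
    qed
    also have "\<dots> \<le> (\<Sum>b\<in>Basis. ?f b y)"
      using b(1) by (intro member_le_sum) auto
    finally show ?thesis by (auto simp: indicator_def)
  qed simp
  then have "P s (indicator {z. R < norm (z - x)}) x \<le> P s (\<lambda>y. \<Sum>b\<in>Basis. ?f b y) x"
    by (rule P_mono)
  also have "\<dots> = (\<Sum>b\<in>Basis. P s (?f b) x)"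
    by (rule P_sum) measurable
  also have "\<dots> = (\<Sum>b\<in>(Basis :: 'a set). ennreal (2 * exp (s / 2 - R / ?d)))"
  proof (rule sum.cong[OF refl])
    fix b :: 'a assume b: "b \<in> Basis"
    have "P s (?f b) x = P s (\<lambda>y. ennreal (exp (- (b \<bullet> x) - R / ?d + b \<bullet> y))) x +
        P s (\<lambda>y. ennreal (exp ((b \<bullet> x) - R / ?d + (- b) \<bullet> y))) x"
      by (rule P_add) measurable
    then show "P s (?f b) x = ennreal (2 * exp (s / 2 - R / ?d))"
      unfolding P_exp_shift[OF s] using b by (simp add: ennreal_plus[symmetric] algebra_simps del: ennreal_plus)
  qed
  also have "\<dots> = ennreal (2 * real DIM('a) * exp (s / 2 - R / real DIM('a)))"
    by (simp add: ennreal_of_nat_eq_real_of_nat ennreal_mult[symmetric] mult_ac)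
  finally show ?thesis .
qed

end

lemma eventually_exp_dominates_power:
  fixes \<delta> C :: real
  assumes "0 < \<delta>" "0 < C"
  shows "\<forall>\<^sub>F h in at_top. h ^ n \<le> C * exp (\<delta> * h)"
proof -
  have "filterlim (\<lambda>h. \<delta> * h) at_top at_top"
    using assms by (intro filterlim_tendsto_pos_mult_at_top[OF tendsto_const] filterlim_ident)
  then have "((\<lambda>h. (\<delta> * h) ^ n / exp (\<delta> * h)) \<longlongrightarrow> 0) at_top"
    using filterlim_compose[OF tendsto_power_div_exp_0] by blast
  then have "\<forall>\<^sub>F h in at_top. (\<delta> * h) ^ n / exp (\<delta> * h) < C * \<delta> ^ n"
    using assms by (intro order_tendstoD) auto
  then show ?thesis
  proof eventually_elim
    case (elim h)
    then have "\<delta> ^ n * h ^ n < \<delta> ^ n * (C * exp (\<delta> * h))"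
      by (simp add: divide_less_eq power_mult_distrib mult_ac)
    then show ?case using assms by simp
  qed
qed

context kpp
begin

text \<open>For \<open>h \<ge> 1\<close> the Gaussian exponent is c^2 h/2 up to a bounded term, so
  the surplus rate a - c^2/2 outweighs every power of \<open>h\<close>. One \<open>r\<close> is the
  offset of the starting point from its moving centre, the other the radius of the target in
  \<open>P_ball_ge\<close>.\<close>

lemma one_step_growth:
  assumes c: "0 < c" and \<delta>: "0 < a - c\<^sup>2 / 2"
  shows "\<exists>h0\<ge>1. \<forall>h\<ge>h0. 1 \<le> exp (a * h) * (measure lborel (ball 0 r :: 'a set) *
    (1 / sqrt (2 * pi * h)) ^ DIM('a) * exp (- (c * h + r + r)\<^sup>2 / (2 * h)))"
proof -
  define \<delta> where "\<delta> = a - c\<^sup>2 / 2"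
  define V where "V = measure lborel (ball 0 r :: 'a set)"
  have V: "0 < V" using r_pos by (simp add: V_def content_ball_pos)
  define C where "C = V * exp (- (4 * c * r + 4 * r\<^sup>2) / 2) * (1 / sqrt (2 * pi)) ^ DIM('a)"
  have C: "0 < C" using V by (simp add: C_def)
  have "\<forall>\<^sub>F h in at_top. h ^ DIM('a) \<le> C * exp (\<delta> * h)"
    using \<delta> C by (intro eventually_exp_dominates_power) (auto simp: \<delta>_def)
  then obtain h1 where h1: "\<And>h. h1 \<le> h \<Longrightarrow> h ^ DIM('a) \<le> C * exp (\<delta> * h)"
    by (auto simp: eventually_at_top_linorder)
  have "1 \<le> exp (a * h) * (V * (1 / sqrt (2 * pi * h)) ^ DIM('a) * exp (- (c * h + r + r)\<^sup>2 / (2 * h)))"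
    if h: "h \<ge> max 1 h1" for h
  proof -
    have "h > 0" using h by simp
    have "sqrt h \<le> h" using h by (intro real_le_lsqrt) (auto simp: power2_eq_square)
    then have "sqrt h ^ DIM('a) \<le> h ^ DIM('a)" using h by (intro power_mono) auto
    also have "\<dots> \<le> C * exp (\<delta> * h)" using h1 h by simp
    finally have "1 \<le> C * exp (\<delta> * h) * (1 / sqrt h) ^ DIM('a)"
      using \<open>h > 0\<close> by (simp add: power_one_over field_simps)
    also have "\<dots> = V * (1 / sqrt (2 * pi * h)) ^ DIM('a) * exp (\<delta> * h - (4 * c * r + 4 * r\<^sup>2) / 2)"
    proof -
      have "exp (\<delta> * h - (4 * c * r + 4 * r\<^sup>2) / 2) = exp (- (4 * c * r + 4 * r\<^sup>2) / 2) * exp (\<delta> * h)"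
        by (simp add: exp_add[symmetric] field_simps)
      moreover have "(1 / sqrt (2 * pi * h)) ^ DIM('a) = (1 / sqrt (2 * pi)) ^ DIM('a) * (1 / sqrt h) ^ DIM('a)"
        by (simp add: real_sqrt_mult power_mult_distrib[symmetric])
      ultimately show ?thesis by (simp only: C_def mult_ac)
    qed
    also have "\<dots> \<le> V * (1 / sqrt (2 * pi * h)) ^ DIM('a) * exp (a * h + (- (c * h + r + r)\<^sup>2 / (2 * h)))"
    proof -
      have "(c * h + r + r)\<^sup>2 / (2 * h) = c\<^sup>2 * h / 2 + 2 * c * r + 2 * r\<^sup>2 / h"
        using \<open>h > 0\<close> by (simp add: field_simps power2_eq_square)
      also have "2 * r\<^sup>2 / h \<le> 2 * r\<^sup>2" using h mult_right_mono[of 1 h "r\<^sup>2"] by (simp add: field_simps)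
      finally have "\<delta> * h - (4 * c * r + 4 * r\<^sup>2) / 2 \<le> a * h + (- (c * h + r + r)\<^sup>2 / (2 * h))"
        by (simp add: \<delta>_def algebra_simps add_divide_distrib)
      then show ?thesis using V \<open>h > 0\<close> by (intro mult_left_mono) auto
    qed
    finally show ?thesis unfolding exp_add by (simp only: mult_ac)
  qed
  then show ?thesis unfolding V_def by (intro exI[of _ "max 1 h1"]) auto
qed

text \<open>The moving ball \<open>ball (j x / k) r\<close> at time \<open>j u / k\<close> carries mass at least \<open>q\<close>: in each step
  of length at least \<open>h\<^sub>0\<close> the exponential growth beats the Gaussian cost of the move.\<close>

lemma v_bounded_below:
  assumes c: "0 < c" "c\<^sup>2 < 2 * \<beta>"
  shows "\<exists>q>0. \<exists>h0>0. q \<le> 1 \<and> (\<forall>u\<ge>h0. \<forall>x. norm x \<le> c * u \<longrightarrow> ennreal q \<le> v u x)"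
proof -
  \<comment> \<open>Half of the surplus \<beta> - c^2/2 is given up to make \<kappa> smaller than 2;
    the other half drives the growth.\<close>
  define k' where "k' = (\<beta> - c\<^sup>2 / 2) / (2 * \<beta>)"
  define \<kappa> where "\<kappa> = 2 - k'"
  have k': "0 < k'" "k' \<le> 1" using c \<beta>_pos by (auto simp: k'_def field_simps)
  have "(\<kappa> - 1) * \<beta> - c\<^sup>2 / 2 = (\<beta> - c\<^sup>2 / 2) / 2"
    using \<beta>_pos by (simp add: \<kappa>_def k'_def field_simps)
  then obtain h0 where h0: "1 \<le> h0" and growth: "\<And>h. h0 \<le> h \<Longrightarrow> 1 \<le> exp ((\<kappa> - 1) * \<beta> * h) *
      (measure lborel (ball 0 r :: 'a set) * (1 / sqrt (2 * pi * h)) ^ DIM('a) * exp (- (c * h + r + r)\<^sup>2 / (2 * h)))"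
    using one_step_growth[OF c(1), of "(\<kappa> - 1) * \<beta>"] c by auto
  \<comment> \<open>A step lasts at most \<open>2 * h0\<close>, and during it a mass
    \<open>q\<close> is multiplied by at most \<open>exp (2 * \<beta> * h0)\<close>. This
    \<open>q\<close> then just reaches 2 - \<kappa>, the bound allowed by
    \<open>v_ge_linear\<close>.\<close>
  define q where "q = k' * exp (- (2 * \<beta> * h0))"
  have q: "0 < q" "q \<le> 1" using k' h0 \<beta>_pos by (auto simp: q_def intro!: mult_le_one)
  have "ennreal q \<le> v u x" if u: "u \<ge> h0" and x: "norm x \<le> c * u" for u x
  proof -
    \<comment> \<open>The largest number of equal steps of length at least \<open>h0\<close>; as
      \<open>u \<ge> h0\<close>, their length is at most \<open>2 * h0\<close>.\<close>
    define k where "k = nat \<lfloor>u / h0\<rfloor>"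
    have uh: "1 \<le> u / h0" using u h0 by simp
    then have k: "1 \<le> k" "real k \<le> u / h0" "u / h0 \<le> real k + 1" unfolding k_def by linarith+
    define h where "h = u / real k"
    define \<xi> where "\<xi> = x /\<^sub>R real k"
    have h: "h0 \<le> h" "h \<le> 2 * h0"
    proof -
      show "h0 \<le> h" using k h0 by (simp add: h_def field_simps)
      have "u \<le> h0 * (real k + 1)" using k h0 by (simp add: field_simps)
      also have "\<dots> \<le> h0 * (2 * real k)" using k h0 by (intro mult_left_mono) auto
      finally show "h \<le> 2 * h0" using k by (simp add: h_def field_simps)
    qed
    have h_pos: "0 < h" using h h0 by simp
    have \<xi>: "norm \<xi> \<le> c * h" using x k by (simp add: \<xi>_def h_def field_simps)
    have "ennreal q \<le> v (real j * h) y" if "y \<in> ball (real j *\<^sub>R \<xi>) r" for j y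
      using that
    proof (induction j arbitrary: y)
      case 0
      then show ?case using q by (simp add: v_0 ennreal_le_1)
    next
      case (Suc j)
      let ?B = "ball (real j *\<^sub>R \<xi>) r"
      let ?f = "\<lambda>y. ennreal q * indicator ?B y"
      have B[measurable]: "indicator ?B \<in> borel_measurable borel" by (intro borel_measurable_indicator) simp
      have "norm (y - real j *\<^sub>R \<xi>) \<le> norm (y - real (Suc j) *\<^sub>R \<xi>) + norm \<xi>"
        using norm_triangle_ineq[of "y - real (Suc j) *\<^sub>R \<xi>" \<xi>] by (simp add: algebra_simps)
      also have "\<dots> \<le> c * h + r" using Suc.prems \<xi> by (simp add: dist_norm norm_minus_commute)
      finally have "ennreal (measure lborel (ball 0 r :: 'a set) * (1 / sqrt (2 * pi * h)) ^ DIM('a)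
          * exp (- (c * h + r + r)\<^sup>2 / (2 * h))) \<le> P h (indicator ?B) y" (is "ennreal ?g \<le> _")
        using P_ball_ge[OF h_pos, of y "real j *\<^sub>R \<xi>" "c * h + r" r] r_pos by simp
      have "ennreal q \<le> ennreal (q * (exp ((\<kappa> - 1) * \<beta> * h) * ?g))"
        using growth[OF h(1)] q by (intro ennreal_leI) simp
      also have "\<dots> = ennreal (exp ((\<kappa> - 1) * \<beta> * h)) * (ennreal q * ennreal ?g)"
        using q h_pos by (simp add: ennreal_mult[symmetric] mult_ac)
      also have "\<dots> \<le> ennreal (exp ((\<kappa> - 1) * \<beta> * h)) * (ennreal q * P h (indicator ?B) y)"
        by (intro mult_left_mono) (fact | simp)+
      also have "\<dots> = ennreal (exp ((\<kappa> - 1) * \<beta> * h)) * P h ?f y"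
        by (simp add: P_cmult[OF B])
      also have "\<dots> \<le> v (real j * h + h) y"
      proof (rule v_ge_linear)
        show "?f y \<le> v (real j * h) y" for y
          using Suc.IH[of y] by (auto simp: indicator_def)
        show "ennreal (exp ((\<kappa> - 1) * \<beta> * u)) * P u ?f y \<le> ennreal (2 - \<kappa>)" if u: "0 \<le> u" "u \<le> h" for u y
        proof -
          have "P u ?f y \<le> P u (\<lambda>_. ennreal q) y" by (intro P_mono) (auto simp: indicator_def)
          then have "ennreal (exp ((\<kappa> - 1) * \<beta> * u)) * P u ?f y \<le> ennreal (exp (2 * \<beta> * h0)) * ennreal q"
          proof (intro mult_mono)
            have "(\<kappa> - 1) * \<beta> * u \<le> 1 * \<beta> * (2 * h0)"
              using u h k' \<beta>_pos h0 by (intro mult_mono) (auto simp: \<kappa>_def)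
            then show "ennreal (exp ((\<kappa> - 1) * \<beta> * u)) \<le> ennreal (exp (2 * \<beta> * h0))"
              by (intro ennreal_leI) simp
          qed (simp_all add: P_const)
          also have "\<dots> = ennreal (2 - \<kappa>)"
          proof -
            have "exp (2 * \<beta> * h0) * q = 2 - \<kappa>" by (simp add: q_def \<kappa>_def exp_minus)
            then show ?thesis using q by (simp add: ennreal_mult[symmetric])
          qed
          finally show ?thesis .
        qed
      qed (use h_pos k' in \<open>auto simp: \<kappa>_def\<close>)
      finally show ?case by (simp add: algebra_simps)
    qed
    from this[of x k] show ?thesis using k r_pos by (simp add: h_def \<xi>_def)
  qed
  then show ?thesis using q h0 by (intro exI[of _ q] conjI exI[of _ h0]) auto
qed

text \<open>\<open>good_step\<close> needs a slightly larger speed in its hypothesis than in its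
  conclusion; the open range of speeds below \<open>C\<close> absorbs this loss.\<close>

definition good :: "real \<Rightarrow> real \<Rightarrow> bool" where
  "good C b \<longleftrightarrow> (\<forall>c. 0 < c \<longrightarrow> c < C \<longrightarrow> (\<exists>u0\<ge>0. \<forall>u\<ge>u0. \<forall>x. norm x \<le> c * u \<longrightarrow> w u x \<le> ennreal b))"

text \<open>Wait for a fixed time. With probability at most \<delta>/2 there is no branching, and
  with probability at most \<delta>/2 the particle leaves the region where \<open>b\<close> is
  valid. Otherwise two independent subtrees both have to miss the ball, which has probability at
  most \<open>b\<^sup>2\<close>.\<close>

lemma good_step:
  assumes g: "good C b" and b: "0 \<le> b" and \<delta>: "0 < \<delta>"
  shows "good C (b\<^sup>2 + \<delta>)"
  unfolding good_def
proof (intro allI impI)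
  fix c assume c: "0 < c" "c < C"
  define c' where "c' = (c + C) / 2"
  have c': "c < c'" "c' < C" using c by (auto simp: c'_def)
  then obtain u0 where u0: "0 \<le> u0" "\<And>u x. u0 \<le> u \<Longrightarrow> norm x \<le> c' * u \<Longrightarrow> w u x \<le> ennreal b"
    using g c unfolding good_def by (metis order.strict_trans)
  let ?d = "real DIM('a)"
  \<comment> \<open>Since exp y \<ge> y, this makes \<open>exp (- \<beta> * H)\<close> at most
    \<delta>/2.\<close>
  define H where "H = 2 / (\<beta> * \<delta>)"
  have H: "0 < H" using \<beta>_pos \<delta> by (simp add: H_def)
  have expH: "exp (- \<beta> * H) \<le> \<delta> / 2"
  proof -
    have "2 / \<delta> \<le> exp (2 / \<delta>)" using exp_ge_add_one_self[of "2 / \<delta>"] by linarith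
    then have "2 / \<delta> \<le> exp (\<beta> * H)" using \<beta>_pos by (simp add: H_def)
    then show ?thesis using \<delta> by (simp add: exp_minus field_simps)
  qed
  have "filterlim (\<lambda>u. ((c' - c) * u - c * H) / ?d - H / 2) at_top at_top"
    using c' by real_asymp
  then have "((\<lambda>u. 2 * ?d * exp (- (((c' - c) * u - c * H) / ?d - H / 2))) \<longlongrightarrow> 2 * ?d * 0) at_top"
    by (intro tendsto_mult tendsto_const filterlim_compose[OF exp_at_bot] filterlim_uminus_at_bot_at_top[THEN filterlim_compose])
  then have "\<forall>\<^sub>F u in at_top. 2 * ?d * exp (- (((c' - c) * u - c * H) / ?d - H / 2)) < \<delta> / 2"
    using \<delta> by (intro order_tendstoD) auto
  then obtain u1 where u1: "\<And>u. u1 \<le> u \<Longrightarrow> 2 * ?d * exp (- (((c' - c) * u - c * H) / ?d - H / 2)) < \<delta> / 2"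
    by (auto simp: eventually_at_top_linorder)
  show "\<exists>u0\<ge>0. \<forall>u\<ge>u0. \<forall>x. norm x \<le> c * u \<longrightarrow> w u x \<le> ennreal (b\<^sup>2 + \<delta>)"
  proof (intro exI[of _ "max u0 u1 + H"] conjI allI impI)
    show "0 \<le> max u0 u1 + H" using u0 H by simp
    fix t and x :: 'a assume t: "max u0 u1 + H \<le> t" and x: "norm x \<le> c * t"
    define u where "u = t - H"
    have u: "u0 \<le> u" "u1 \<le> u" "0 \<le> u" "t = u + H" using t u0 by (auto simp: u_def)
    \<comment> \<open>A displacement of at most \<open>R\<close> takes a point of norm at most
      \<open>c * t\<close> to one of norm at most \<open>c' * u\<close>.\<close>
    define R where "R = (c' - c) * u - c * H"
    let ?I = "indicator {z. R < norm (z - x)} :: 'a \<Rightarrow> ennreal"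
    have I[measurable]: "?I \<in> borel_measurable borel" by (intro borel_measurable_indicator) measurable
    have "w t x = Q H (w u) (\<lambda>s y. w (u + s) y * w (u + s) y) x"
      unfolding u(4) using u H by (intro w_restart) auto
    also have "\<dots> \<le> Q H (\<lambda>_. 1) (\<lambda>_ y. ennreal (b\<^sup>2) + ?I y) x"
    proof (rule Q_mono)
      fix s y assume s: "0 \<le> s" "s \<le> H"
      show "w (u + s) y * w (u + s) y \<le> ennreal (b\<^sup>2) + ?I y"
      proof (cases "R < norm (y - x)")
        case True
        have "w (u + s) y * w (u + s) y \<le> 1 * 1" by (intro mult_mono w_le_1) auto
        then show ?thesis using True by (simp add: add_increasing)
      next
        case False
        have "norm y \<le> norm (y - x) + norm x" using norm_triangle_ineq[of "y - x" x] by simp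
        also have "\<dots> \<le> R + c * (u + H)" using False x u by simp
        also have "\<dots> = c' * u" by (simp add: R_def algebra_simps)
        also have "\<dots> \<le> c' * (u + s)" using s c c' by (intro mult_left_mono) auto
        finally have "w (u + s) y \<le> ennreal b" using u0 u s by auto
        then have "w (u + s) y * w (u + s) y \<le> ennreal b * ennreal b" by (intro mult_mono) auto
        then show ?thesis using b by (simp add: ennreal_mult[symmetric] power2_eq_square add_increasing2)
      qed
    qed (rule w_le_1)
    also have "\<dots> \<le> ennreal (exp (- \<beta> * H) * 1 + (b\<^sup>2 + \<delta> / 2))"
    proof (rule Q_le)
      fix s assume s: "0 \<le> s" "s \<le> H"
      have "P s (\<lambda>y. ennreal (b\<^sup>2) + ?I y) x = ennreal (b\<^sup>2) + P s ?I x"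
        by (subst P_add) (simp_all add: P_const)
      also have "P s ?I x \<le> ennreal (2 * ?d * exp (s / 2 - R / ?d))" by (rule P_tail[OF s(1)])
      also have "\<dots> \<le> ennreal (2 * ?d * exp (- (((c' - c) * u - c * H) / ?d - H / 2)))"
        using s by (intro ennreal_leI mult_left_mono) (auto simp: R_def)
      also have "\<dots> \<le> ennreal (\<delta> / 2)" using u1[OF u(2)] by (intro ennreal_leI) simp
      finally show "P s (\<lambda>y. ennreal (b\<^sup>2) + ?I y) x \<le> ennreal (b\<^sup>2 + \<delta> / 2)"
        using \<delta> by (simp add: ennreal_plus)
    qed (use H \<delta> in auto)
    also have "\<dots> \<le> ennreal (b\<^sup>2 + \<delta>)" using expH by (intro ennreal_leI) simp
    finally show "w t x \<le> ennreal (b\<^sup>2 + \<delta>)" .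
  qed
qed

text \<open>Repeated squaring drives any bound below 1 to 0, and \<open>v_bounded_below\<close>
  supplies such a bound. Instead of iterating, the infimum of the admissible bounds is considered:
  if it were positive, \<open>good_step\<close> would lead below it.\<close>

lemma good_all:
  assumes C: "0 < C" "C\<^sup>2 < 2 * \<beta>" and \<eta>: "0 < \<eta>"
  shows "good C \<eta>"
proof -
  obtain q h0 where q: "0 < q" "q \<le> 1" and h0: "0 < h0"
    and v: "\<And>u x. h0 \<le> u \<Longrightarrow> norm x \<le> C * u \<Longrightarrow> ennreal q \<le> v u x"
    using v_bounded_below[OF C] by blast
  have good_q: "good C (1 - q)"
    unfolding good_def
  proof (intro allI impI exI[of _ h0] conjI)
    fix c u and x :: 'a assume c: "0 < c" "c < C" and u: "h0 \<le> u" and x: "norm x \<le> c * u"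
    have "c * u \<le> C * u" using c u h0 by (intro mult_right_mono) auto
    with v[OF u] x have "ennreal q \<le> v u x" by simp
    moreover obtain a where "0 \<le> a" "w u x = ennreal (1 - a)" "v u x = ennreal a" by (rule w_v_real)
    ultimately show "w u x \<le> ennreal (1 - q)" by (simp add: ennreal_leI)
  qed (use h0 in auto)
  define S where "S = {b. 0 \<le> b \<and> good C b}"
  define b where "b = Inf S"
  have S: "1 - q \<in> S" "bdd_below S" using good_q q by (auto simp: S_def bdd_below_def)
  have b: "0 \<le> b" "b \<le> 1 - q" unfolding b_def using S by (auto intro!: cInf_greatest cInf_lower simp: S_def)
  have "b = 0"
  proof (rule ccontr)
    assume "b \<noteq> 0"
    with b q have b': "0 < b" "b < 1" by auto
    \<comment> \<open>For 0 < b < 1 some admissible a has a^2 < b, and the gap leaves room for the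
      error term (b - a^2)/2.\<close>
    then have "b * b < b * 1" by (intro mult_strict_left_mono) auto
    then have "b < sqrt b" by (intro real_less_rsqrt) (simp add: power2_eq_square)
    then obtain a where a: "a \<in> S" "a < sqrt b"
      using S cInf_less_iff[of S "sqrt b"] unfolding b_def by auto
    then have "a\<^sup>2 < b" using b by (metis S_def mem_Collect_eq power_strict_mono real_sqrt_pow2 zero_less_numeral)
    then have "good C (a\<^sup>2 + (b - a\<^sup>2) / 2)" using a by (intro good_step) (auto simp: S_def)
    then have "a\<^sup>2 + (b - a\<^sup>2) / 2 \<in> S" using \<open>a\<^sup>2 < b\<close> unfolding S_def mem_Collect_eq
      by (intro conjI add_nonneg_nonneg) simp_all
    then have "b \<le> a\<^sup>2 + (b - a\<^sup>2) / 2" unfolding b_def using S by (intro cInf_lower) auto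
    then have "2 * b \<le> 2 * (a\<^sup>2 + (b - a\<^sup>2) / 2)" by (rule mult_left_mono) simp
    then have "2 * b \<le> a\<^sup>2 + b" by (simp add: distrib_left diff_divide_distrib)
    then show False using \<open>a\<^sup>2 < b\<close> by simp
  qed
  then obtain a where a: "a \<in> S" "a < \<eta>" using S \<eta> cInf_less_iff[of S \<eta>] unfolding b_def by auto
  then show ?thesis unfolding good_def S_def
    by (auto simp: good_def) (meson ennreal_leI less_imp_le order_trans)
qed

lemma w_small:
  assumes c: "0 < c" "c\<^sup>2 < 2 * \<beta>" and \<eta>: "0 < \<eta>"
  shows "\<exists>u0\<ge>0. \<forall>u\<ge>u0. \<forall>x. norm x \<le> c * u \<longrightarrow> w u x \<le> ennreal \<eta>"
proof -
  have "c < sqrt (2 * \<beta>)" using c by (intro real_less_rsqrt)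
  then obtain C where C: "c < C" "C < sqrt (2 * \<beta>)" using dense by blast
  then have "C\<^sup>2 < (sqrt (2 * \<beta>))\<^sup>2" using c by (intro power_strict_mono) auto
  then show ?thesis using good_all[of C, OF _ _ \<eta>] C c \<beta>_pos unfolding good_def by auto
qed

end

section \<open>Exponential bounds\<close>

text \<open>Compactness of the sphere. Up to the factor \<rho>, the norm is replaced by a maximum of
  finitely many linear functionals: \<open>exp (b * norm x)\<close> does not solve the linear
  equation exactly, exponentials of linear functionals do.\<close>

lemma finite_direction_net:
  assumes "\<rho> < 1"
  shows "\<exists>F. finite F \<and> (\<forall>n\<in>F. norm n = 1) \<and> (\<forall>x::'a::euclidean_space. \<exists>n\<in>F. \<rho> * norm x \<le> n \<bullet> x)"
proof -
  obtain F where F: "F \<subseteq> sphere (0::'a) 1" "finite F" "sphere (0::'a) 1 \<subseteq> (\<Union>n\<in>F. ball n (1 - \<rho>))"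
  proof (rule compactE_image[OF compact_sphere])
    show "sphere (0::'a) 1 \<subseteq> (\<Union>n\<in>sphere 0 1. ball n (1 - \<rho>))" using assms by auto
  qed auto
  have "\<exists>n\<in>F. \<rho> * norm x \<le> n \<bullet> x" for x :: 'a
  proof (cases "x = 0")
    case True
    obtain b :: 'a where "b \<in> Basis" using nonempty_Basis by blast
    then have "b \<in> sphere 0 1" by simp
    then have "F \<noteq> {}" using F(3) by auto
    then show ?thesis using True by auto
  next
    case False
    define y where "y = x /\<^sub>R norm x"
    have y: "norm y = 1" "x = norm x *\<^sub>R y" using False by (simp_all add: y_def)
    then obtain n where n: "n \<in> F" "norm (n - y) < 1 - \<rho>" using F(3) by (auto simp: dist_norm)
    have "\<bar>(n - y) \<bullet> y\<bar> \<le> 1 - \<rho>" using Cauchy_Schwarz_ineq2[of "n - y" y] n y by simp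
    moreover have "y \<bullet> y = 1" using y by (simp add: dot_square_norm)
    ultimately have "\<rho> \<le> n \<bullet> y" by (simp add: inner_diff_left)
    then have "\<rho> * norm x \<le> n \<bullet> (norm x *\<^sub>R y)"
      using mult_right_mono[of \<rho> "n \<bullet> y" "norm x"] by (simp add: mult.commute)
    then show ?thesis using n(1) y(2) by auto
  qed
  moreover have "\<forall>n\<in>F. norm n = 1" using F(1) by auto
  ultimately show ?thesis using F(2) by blast
qed

text \<open>Logarithm of a Gaussian bound for covering the distance \<open>A * t + B\<close> in time
  \<open>\<sigma> * t\<close>; the normalising factor contributes only order ln t / t.\<close>

lemma tendsto_log_lower_rate:
  fixes k p d A B \<sigma> :: real
  assumes \<sigma>: "0 < \<sigma>"
  shows "((\<lambda>t. (1 / t) * (k - p * t - d * ln (sqrt (2 * pi * (\<sigma> * t))) - (A * t + B)\<^sup>2 / (2 * (\<sigma> * t))))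
    \<longlongrightarrow> - p - A\<^sup>2 / (2 * \<sigma>)) at_top"
proof -
  have "((\<lambda>t. k * (1 / t) - p - d * (ln (sqrt (2 * pi * (\<sigma> * t))) / t) - (A + B * (1 / t))\<^sup>2 / (2 * \<sigma>))
      \<longlongrightarrow> k * 0 - p - d * 0 - (A + B * 0)\<^sup>2 / (2 * \<sigma>)) at_top"
  proof (intro tendsto_intros)
    show "((\<lambda>t. 1 / t :: real) \<longlongrightarrow> 0) at_top" by real_asymp
    show "((\<lambda>t. ln (sqrt (2 * pi * (\<sigma> * t))) / t) \<longlongrightarrow> 0) at_top" using \<sigma> by real_asymp
    show "((\<lambda>t. 1 / t :: real) \<longlongrightarrow> 0) at_top" by real_asymp
  qed (use \<sigma> in auto)
  moreover have "\<forall>\<^sub>F t in at_top. k * (1 / t) - p - d * (ln (sqrt (2 * pi * (\<sigma> * t))) / t) - (A + B * (1 / t))\<^sup>2 / (2 * \<sigma>)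
      = (1 / t) * (k - p * t - d * ln (sqrt (2 * pi * (\<sigma> * t))) - (A * t + B)\<^sup>2 / (2 * (\<sigma> * t)))"
    using eventually_gt_at_top[of 0]
  proof eventually_elim
    case (elim t)
    have "A * t + B = (A + B * (1 / t)) * t" using elim by (simp add: field_simps)
    then have "(A * t + B)\<^sup>2 / (2 * (\<sigma> * t)) = (A + B * (1 / t))\<^sup>2 / (2 * \<sigma>) * t"
      using elim \<sigma> by (simp add: power_mult_distrib power2_eq_square)
    then show ?case using elim by (simp add: right_diff_distrib)
  qed
  ultimately show ?thesis by (simp add: tendsto_cong)
qed

context kpp
begin

text \<open>Inside the cone of slope \<open>C\<close> the square is at most \<kappa>w; outside it
  the plane waves together already exceed 1/\<kappa>. The two regions fit because the net of
  directions is taken with \<rho> = c0/C, so the exponent vanishes on the boundary of the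
  cone.\<close>

lemma w_upper_bound:
  assumes b: "0 < b" and c0: "0 < c0" "c0\<^sup>2 < 2 * \<beta>" and bc: "b * c0 + b\<^sup>2 / 2 < \<beta>"
  shows "\<exists>K>0. \<exists>u0\<ge>0. \<forall>t\<ge>u0. \<forall>x. w t x \<le> ennreal (K * exp (b * norm x - b * c0 * t))"
proof -
  \<comment> \<open>Growth (\<kappa> - 1)\<beta> plus the heat contribution b^2/2 is then -b c0, so
    every wave moves with speed \<open>c0\<close>. Positivity of \<kappa> is the strict inequality
    \<open>bc\<close>.\<close>
  define \<kappa> where "\<kappa> = 1 - (b * c0 + b\<^sup>2 / 2) / \<beta>"
  have \<kappa>: "0 < \<kappa>" "\<kappa> < 1" using b c0 bc \<beta>_pos by (auto simp: \<kappa>_def field_simps add_pos_pos)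
  have k\<beta>: "(\<kappa> - 1) * \<beta> = - (b * c0 + b\<^sup>2 / 2)" using \<beta>_pos by (simp add: \<kappa>_def)
  have "c0 < sqrt (2 * \<beta>)" using c0 by (intro real_less_rsqrt)
  then obtain C where C: "c0 < C" "C < sqrt (2 * \<beta>)" using dense by blast
  then have "C\<^sup>2 < (sqrt (2 * \<beta>))\<^sup>2" using c0 by (intro power_strict_mono) auto
  then have C2: "C\<^sup>2 < 2 * \<beta>" using \<beta>_pos by simp
  obtain u0 where u0: "0 \<le> u0" "\<And>u x. u0 \<le> u \<Longrightarrow> norm x \<le> C * u \<Longrightarrow> w u x \<le> ennreal \<kappa>"
    using w_small[of C \<kappa>] C C2 c0 \<kappa> by auto
  obtain F where F: "finite F" "\<And>n. n \<in> F \<Longrightarrow> norm n = 1" "\<And>x::'a. \<exists>n\<in>F. c0 / C * norm x \<le> n \<bullet> x"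
    using finite_direction_net[of "c0 / C"] C c0 by auto
  \<comment> \<open>The prefactor 1/\<kappa>, written as an exponential for
    \<open>P_exp_shift\<close>, makes \<kappa>m at least 1 outside the cone.\<close>
  define f where "f y = (\<Sum>n\<in>F. ennreal (exp (ln (1 / \<kappa>) + (b *\<^sub>R n) \<bullet> y)))" for y
  have f[measurable]: "f \<in> borel_measurable borel" unfolding f_def by measurable
  define m where "m h y = (\<Sum>n\<in>F. ennreal (exp (ln (1 / \<kappa>) - b * c0 * h + b * (n \<bullet> y))))" for h y
  have m: "ennreal (exp ((\<kappa> - 1) * \<beta> * h)) * P h f y = m h y" if h: "0 \<le> h" for h y
  proof -
    have "P h f y = (\<Sum>n\<in>F. P h (\<lambda>y. ennreal (exp (ln (1 / \<kappa>) + (b *\<^sub>R n) \<bullet> y))) y)"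
      unfolding f_def by (rule P_sum) measurable
    also have "\<dots> = (\<Sum>n\<in>F. ennreal (exp (ln (1 / \<kappa>) + b\<^sup>2 * h / 2 + b * (n \<bullet> y))))"
      unfolding P_exp_shift[OF h] using F b by (intro sum.cong) auto
    finally have P: "P h f y = (\<Sum>n\<in>F. ennreal (exp (ln (1 / \<kappa>) + b\<^sup>2 * h / 2 + b * (n \<bullet> y))))" .
    show ?thesis
      unfolding m_def k\<beta> P
      unfolding sum_distrib_left
      by (intro sum.cong refl) (simp add: ennreal_mult[symmetric] exp_add[symmetric] algebra_simps)
  qed
  have m_ge: "ennreal (1 / \<kappa> * exp (b * c0 / C * norm y - b * c0 * h)) \<le> m h y" for h y
  proof -
    obtain n where n: "n \<in> F" "c0 / C * norm y \<le> n \<bullet> y" using F(3) by blast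
    have "1 / \<kappa> * exp (b * c0 / C * norm y - b * c0 * h) = exp (ln (1 / \<kappa>) - b * c0 * h + b * (c0 / C * norm y))"
      using \<kappa> by (simp add: exp_add exp_diff exp_minus field_simps)
    also have "\<dots> \<le> exp (ln (1 / \<kappa>) - b * c0 * h + b * (n \<bullet> y))"
      using mult_left_mono[OF n(2) less_imp_le[OF b]] by simp
    finally have "ennreal (1 / \<kappa> * exp (b * c0 / C * norm y - b * c0 * h)) \<le> ennreal (exp (ln (1 / \<kappa>) - b * c0 * h + b * (n \<bullet> y)))"
      by (rule ennreal_leI)
    also have "\<dots> \<le> m h y" unfolding m_def using n F by (intro member_le_sum) auto
    finally show ?thesis .
  qed
  have main: "w (u0 + h) x \<le> m h x" if h: "0 \<le> h" for h x
  proof -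
    have "w (u0 + h) x \<le> ennreal (exp ((\<kappa> - 1) * \<beta> * h)) * P h f x"
    proof (rule w_le_linear)
      show "w u0 y \<le> f y" for y
      proof -
        have "1 \<le> 1 / \<kappa> * exp (b * c0 / C * norm y - b * c0 * 0)"
          using \<kappa> b c0 C by (intro mult_ge1_I) (auto simp: field_simps)
        then have "1 \<le> ennreal (1 / \<kappa> * exp (b * c0 / C * norm y - b * c0 * 0))" by (simp add: ennreal_leI flip: ennreal_1)
        also have "\<dots> \<le> m 0 y" by (rule m_ge)
        also have "m 0 y = f y" using m[of 0 y] by (simp add: P_0)
        finally show ?thesis using w_le_1 order_trans by blast
      qed
      show "w (u0 + u) y * w (u0 + u) y \<le> ennreal \<kappa> * max (w (u0 + u) y) (ennreal (exp ((\<kappa> - 1) * \<beta> * u)) * P u f y)"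
        if u: "0 \<le> u" for u y
      proof (cases "norm y \<le> C * (u0 + u)")
        case True
        then have "w (u0 + u) y \<le> ennreal \<kappa>" using u0 u by simp
        then show ?thesis by (intro mult_mono) auto
      next
        case False
        have "C * u \<le> C * (u0 + u)" using u0 C c0 by (intro mult_left_mono) auto
        with False have "C * u \<le> norm y" by simp
        then have "b * c0 / C * (C * u) \<le> b * c0 / C * norm y" using b c0 C by (intro mult_left_mono) auto
        then have "b * c0 * u \<le> b * c0 / C * norm y" using C c0 by simp
        then have "1 / \<kappa> * 1 \<le> 1 / \<kappa> * exp (b * c0 / C * norm y - b * c0 * u)"
          using \<kappa> by (intro mult_left_mono) auto
        then have "ennreal (1 / \<kappa>) \<le> m u y" using order_trans[OF ennreal_leI m_ge] by simp
        then have "ennreal \<kappa> * ennreal (1 / \<kappa>) \<le> ennreal \<kappa> * max (w (u0 + u) y) (m u y)"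
          by (intro mult_left_mono) (auto simp: le_max_iff_disj)
        moreover have "ennreal \<kappa> * ennreal (1 / \<kappa>) = 1" using \<kappa> by (simp add: ennreal_mult[symmetric])
        moreover have "w (u0 + u) y * w (u0 + u) y \<le> 1 * 1" by (intro mult_mono w_le_1) auto
        ultimately show ?thesis unfolding m[OF u] by (auto intro: order_trans)
      qed
    qed (use u0 h \<kappa> in auto)
    then show ?thesis unfolding m[OF h] .
  qed
  have "w t x \<le> ennreal ((real (card F) + 1) / \<kappa> * exp (b * c0 * u0) * exp (b * norm x - b * c0 * t))"
    if t: "u0 \<le> t" for t x
  proof -
    let ?E = "1 / \<kappa> * exp (b * c0 * u0) * exp (b * norm x - b * c0 * t)"
    have "w t x \<le> m (t - u0) x" using main[of "t - u0" x] t by simp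
    also have "\<dots> \<le> (\<Sum>n\<in>F. ennreal ?E)"
      unfolding m_def
    proof (intro sum_mono ennreal_leI)
      fix n assume n: "n \<in> F"
      have "n \<bullet> x \<le> norm x" using norm_cauchy_schwarz[of n x] F(2)[OF n] by simp
      then have "b * (n \<bullet> x) \<le> b * norm x" using b by simp
      then have "exp (ln (1 / \<kappa>) - b * c0 * (t - u0) + b * (n \<bullet> x)) \<le> exp (ln (1 / \<kappa>) + b * c0 * u0 + (b * norm x - b * c0 * t))"
        by (simp add: algebra_simps)
      also have "\<dots> = ?E" using \<kappa> unfolding exp_add by simp
      finally show "exp (ln (1 / \<kappa>) - b * c0 * (t - u0) + b * (n \<bullet> x)) \<le> ?E" .
    qed
    also have "\<dots> = ennreal (real (card F) * ?E)"
      by (simp add: ennreal_of_nat_eq_real_of_nat ennreal_mult[symmetric] \<kappa> less_imp_le)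
    also have "\<dots> \<le> ennreal ((real (card F) + 1) * ?E)"
      using \<kappa> by (intro ennreal_leI mult_right_mono) auto
    finally show ?thesis by (simp add: mult_ac)
  qed
  moreover have "0 < (real (card F) + 1) / \<kappa> * exp (b * c0 * u0)" using \<kappa> by simp
  ultimately show ?thesis using u0(1) by blast
qed

text \<open>First moment with an exponential tilt towards \<open>z\<close>: the growth exp(\<beta>u)
  loses against the Gaussian cost exp(-c1^2 u/2), since \<open>c1\<close> exceeds the critical
  speed.\<close>

lemma w_far:
  assumes c1: "0 < c1" "2 * \<beta> < c1\<^sup>2"
  shows "\<exists>u1\<ge>0. \<forall>u\<ge>u1. \<forall>z. c1 * u + r \<le> norm z \<longrightarrow> ennreal (1/2) \<le> w u z"
proof -
  define \<delta> where "\<delta> = c1\<^sup>2 / 2 - \<beta>"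
  have \<delta>: "0 < \<delta>" using c1 by (simp add: \<delta>_def)
  have "ennreal (1/2) \<le> w u z" if u: "ln 2 / \<delta> \<le> u" and z: "c1 * u + r \<le> norm z" for u z
  proof -
    have u0: "0 \<le> u" using u \<delta> by (auto intro: order_trans[rotated])
    define n where "n = z /\<^sub>R norm z"
    have z0: "z \<noteq> 0" using z r_pos mult_nonneg_nonneg[OF less_imp_le[OF c1(1)] u0] by auto
    have n: "norm n = 1" "n \<bullet> z = norm z"
      using z0 by (auto simp: n_def dot_square_norm power2_eq_square)
    \<comment> \<open>The exponent is c1(r - n \<bullet> y), which is nonnegative on the
      ball.\<close>
    have "P u (indicator (ball 0 r)) z \<le> P u (\<lambda>y. ennreal (exp (c1 * r + (- c1 *\<^sub>R n) \<bullet> y))) z"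
    proof (rule P_mono)
      fix y :: 'a
      show "indicator (ball 0 r) y \<le> ennreal (exp (c1 * r + (- c1 *\<^sub>R n) \<bullet> y))"
      proof (cases "y \<in> ball 0 r")
        case True
        then have "n \<bullet> y \<le> r" using norm_cauchy_schwarz[of n y] n by simp
        then have "c1 * (n \<bullet> y) \<le> c1 * r" using c1 by simp
        then have "1 \<le> exp (c1 * r + (- c1 *\<^sub>R n) \<bullet> y)" by simp
        then show ?thesis using True by (simp flip: ennreal_1)
      qed simp
    qed
    also have "\<dots> = ennreal (exp (c1 * r + c1\<^sup>2 * u / 2 - c1 * norm z))"
      unfolding P_exp_shift[OF u0] using n by simp
    also have "\<dots> \<le> ennreal (exp (- (c1\<^sup>2 * u / 2)))"
    proof -
      have "c1 * (c1 * u + r) \<le> c1 * norm z" using z c1 by simp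
      then show ?thesis by (intro ennreal_leI) (simp add: algebra_simps power2_eq_square)
    qed
    finally have "v u z \<le> ennreal (exp (\<beta> * u)) * ennreal (exp (- (c1\<^sup>2 * u / 2)))"
      using v_le_linear[OF u0, of z] by (blast intro: order_trans mult_left_mono zero_le)
    also have "\<dots> = ennreal (exp (- (\<delta> * u)))"
      by (simp add: ennreal_mult[symmetric] exp_add[symmetric] \<delta>_def algebra_simps)
    also have "\<dots> \<le> ennreal (1/2)"
    proof (rule ennreal_leI)
      have "ln 2 \<le> \<delta> * u" using u \<delta> by (simp add: field_simps)
      then have "exp (- (\<delta> * u)) \<le> exp (- ln (2::real))" by simp
      then show "exp (- (\<delta> * u)) \<le> 1/2" by (simp add: exp_minus)
    qed
    finally have "v u z \<le> ennreal (1/2)" .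
    moreover obtain a where a: "0 \<le> a" "a \<le> 1" "w u z = ennreal (1 - a)" "v u z = ennreal a" by (rule w_v_real)
    ultimately have "ennreal a \<le> ennreal (1/2)" by (simp only:)
    then have "a \<le> 1/2" by (subst (asm) ennreal_le_iff) simp_all
    then show ?thesis unfolding a(3) by (intro ennreal_leI) simp
  qed
  then show ?thesis using \<delta> by (intro exI[of _ "ln 2 / \<delta>"]) auto
qed

text \<open>No branching before time \<open>s\<close>, and the initial particle moves outwards to distance \<open>c\<^sub>1 u + r\<close>.\<close>

lemma w_lower_bound:
  assumes c1: "0 < c1" "2 * \<beta> < c1\<^sup>2"
  shows "\<exists>u1\<ge>0. \<forall>u s x. u1 \<le> u \<longrightarrow> 0 < s \<longrightarrow> norm x \<le> c1 * u + r \<longrightarrow>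
    ennreal (1/2 * exp (- \<beta> * s) * (measure lborel (ball 0 1 :: 'a set) * (1 / sqrt (2 * pi * s)) ^ DIM('a)
      * exp (- (c1 * u + r + 2 - norm x)\<^sup>2 / (2 * s)))) \<le> w (u + s) x"
proof -
  obtain u1 where u1: "0 \<le> u1" "\<And>u z. u1 \<le> u \<Longrightarrow> c1 * u + r \<le> norm z \<Longrightarrow> ennreal (1/2) \<le> w u z"
    using w_far[OF c1] by blast
  have "ennreal (1/2 * exp (- \<beta> * s) * (measure lborel (ball 0 1 :: 'a set) * (1 / sqrt (2 * pi * s)) ^ DIM('a)
      * exp (- (c1 * u + r + 2 - norm x)\<^sup>2 / (2 * s)))) \<le> w (u + s) x"
    if u: "u1 \<le> u" and s: "0 < s" and x: "norm x \<le> c1 * u + r" for u s x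
  proof -
    define R where "R = c1 * u + r"
    obtain n where n: "norm n = 1" "x = norm x *\<^sub>R n"
    proof (cases "x = 0")
      case True
      obtain b :: 'a where "b \<in> Basis" using nonempty_Basis by blast
      then show ?thesis using True by (intro that[of b]) auto
    next
      case False
      then show ?thesis by (intro that[of "x /\<^sub>R norm x"]) auto
    qed
    \<comment> \<open>A unit ball just outside radius \<open>R\<close>, in the direction of
      \<open>x\<close>. Its centre is at distance \<open>R + 1 - norm x\<close>, and
      \<open>P_ball_ge\<close> adds the radius 1, hence the \<open>+ 2\<close>.\<close>
    let ?B = "ball ((R + 1) *\<^sub>R n) 1"
    have B[measurable]: "indicator ?B \<in> borel_measurable borel" by (intro borel_measurable_indicator) simp
    have "x - (R + 1) *\<^sub>R n = (norm x - (R + 1)) *\<^sub>R n" by (subst n(2)) (simp add: scaleR_left_diff_distrib)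
    then have "norm (x - (R + 1) *\<^sub>R n) \<le> R + 1 - norm x" using n x by (simp add: R_def)
    from P_ball_ge[OF s this, of 1]
    have g: "ennreal (measure lborel (ball 0 1 :: 'a set) * (1 / sqrt (2 * pi * s)) ^ DIM('a)
      * exp (- (R + 2 - norm x)\<^sup>2 / (2 * s))) \<le> P s (indicator ?B) x" (is "ennreal ?g \<le> _")
      by (simp add: algebra_simps)
    have "1/2 * exp (- \<beta> * s) * ?g = exp (- \<beta> * s) * (1/2 * ?g)" by (simp only: mult_ac)
    then have "ennreal (1/2 * exp (- \<beta> * s) * ?g) = ennreal (exp (- \<beta> * s)) * (ennreal (1/2) * ennreal ?g)"
      using ennreal_mult'[of "exp (- \<beta> * s)" "1/2 * ?g"] ennreal_mult'[of "1/2" ?g] by simp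
    also have "\<dots> \<le> ennreal (exp (- \<beta> * s)) * (ennreal (1/2) * P s (indicator ?B) x)"
      using g by (intro mult_left_mono) auto
    also have "\<dots> = ennreal (exp (- \<beta> * s)) * P s (\<lambda>y. ennreal (1/2) * indicator ?B y) x"
      by (simp add: P_cmult[OF B])
    also have "\<dots> \<le> ennreal (exp (- \<beta> * s)) * P s (w u) x"
    proof (intro mult_left_mono P_mono)
      fix y :: 'a
      show "ennreal (1/2) * indicator ?B y \<le> w u y"
      proof (cases "y \<in> ?B")
        case True
        then have "norm ((R + 1) *\<^sub>R n - y) < 1" by (simp add: dist_norm)
        moreover have "R + 1 \<le> norm ((R + 1) *\<^sub>R n)" using n by simp
        ultimately have "R \<le> norm y" using norm_triangle_ineq2[of "(R + 1) *\<^sub>R n" y] by linarith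
        then show ?thesis using True u1(2)[OF u] by (simp add: R_def)
      qed simp
    qed simp
    also have "\<dots> \<le> w (u + s) x"
      using u u1 s unfolding w_restart[of u s x, OF order_trans[OF u1(1) u] less_imp_le[OF s]] duhamel_def
      by (simp add: add_increasing2)
    finally show ?thesis by (simp add: R_def)
  qed
  then show ?thesis using u1(1) by blast
qed

section \<open>Exponential rates\<close>

lemma log_asymptotics_less:
  assumes \<theta>: "0 \<le> \<theta>" "\<theta> < 1" and a: "0 \<le> a" and x: "\<And>t. 0 \<le> t \<Longrightarrow> norm (x t) = a + \<theta> * sqrt (2 * \<beta>) * t"
    and L: "l < - 2 * \<beta> * (sqrt 2 - 1) * (1 - \<theta>)"
  shows "\<forall>\<^sub>F t in at_top. 0 < enn2real (w t (x t)) \<and> l < (1 / t) * ln (enn2real (w t (x t)))"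
proof -
  define s0 where "s0 = sqrt (2 * \<beta>)"
  have s0: "0 < s0" "s0\<^sup>2 = 2 * \<beta>" using \<beta>_pos by (auto simp: s0_def)
  \<comment> \<open>Minimiser of \<beta>\<sigma> + \<beta>(1 - \<theta> - \<sigma>)^2/\<sigma>, the
    combined cost of not branching and of moving outwards up to time \<sigma>t.\<close>
  define \<sigma> where "\<sigma> = (1 - \<theta>) / sqrt 2"
  have "1 < sqrt (2::real)" by simp
  then have "\<sigma> < 1 - \<theta>" using \<theta> unfolding \<sigma>_def by (simp add: divide_less_eq)
  then have \<sigma>: "0 < \<sigma>" "\<sigma> < 1 - \<theta>" using \<theta> by (auto simp: \<sigma>_def)
  \<comment> \<open>Up to a constant, \<open>A \<mu> * t\<close> is the distance from the starting
    radius to the radius \<mu> sqrt(2\<beta>)(1 - \<sigma>)t.\<close>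
  define A where "A \<mu> = \<mu> * s0 * (1 - \<sigma>) - \<theta> * s0" for \<mu>
  define rate where "rate \<mu> = - \<beta> * \<sigma> - (A \<mu>)\<^sup>2 / (2 * \<sigma>)" for \<mu>
  have "rate 1 = - 2 * \<beta> * (sqrt 2 - 1) * (1 - \<theta>)"
  proof -
    have "(A 1)\<^sup>2 = 2 * \<beta> * (1 - \<theta> - \<sigma>)\<^sup>2"
      unfolding A_def s0(2)[symmetric] by (simp add: power2_eq_square algebra_simps)
    then have "rate 1 = - \<beta> * \<sigma> - \<beta> * (1 - \<theta> - \<sigma>)\<^sup>2 / \<sigma>" by (simp add: rate_def)
    also have "\<dots> = - 2 * \<beta> * (sqrt 2 - 1) * (1 - \<theta>)"
    proof -
      have e: "1 - \<theta> = sqrt 2 * \<sigma>" by (simp add: \<sigma>_def)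
      have "(sqrt 2 * \<sigma> - \<sigma>)\<^sup>2 = (3 - 2 * sqrt 2) * \<sigma> * \<sigma>"
        by (simp add: power2_eq_square algebra_simps)
      then have "\<beta> * (sqrt 2 * \<sigma> - \<sigma>)\<^sup>2 / \<sigma> = \<beta> * (3 - 2 * sqrt 2) * \<sigma>" using \<sigma> by simp
      then show ?thesis unfolding e by (simp add: algebra_simps)
    qed
    finally show ?thesis .
  qed
  \<comment> \<open>\<open>w_far\<close> needs a speed strictly above the critical one, so \<mu> > 1
    is chosen and continuity recovers the rate at 1.\<close>
  moreover have "(rate \<longlongrightarrow> rate 1) (at_right 1)"
    unfolding rate_def A_def using \<sigma> by (intro tendsto_intros) auto
  ultimately have "\<forall>\<^sub>F \<mu> in at_right 1. l < rate \<mu>"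
    using L by (intro order_tendstoD) auto
  then obtain \<mu> where \<mu>: "1 < \<mu>" "l < rate \<mu>"
    unfolding eventually_at_right_field by (metis dense)
  have "s0\<^sup>2 < (\<mu> * s0)\<^sup>2" using \<mu> s0 by (intro power_strict_mono) auto
  then obtain u1 where u1: "0 \<le> u1" and lower: "\<And>u s x. u1 \<le> u \<Longrightarrow> 0 < s \<Longrightarrow> norm x \<le> \<mu> * s0 * u + r \<Longrightarrow>
    ennreal (1/2 * exp (- \<beta> * s) * (measure lborel (ball 0 1 :: 'a set) * (1 / sqrt (2 * pi * s)) ^ DIM('a)
      * exp (- (\<mu> * s0 * u + r + 2 - norm x)\<^sup>2 / (2 * s)))) \<le> w (u + s) x"
    using w_lower_bound[of "\<mu> * s0"] s0 \<mu> by auto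
  define V where "V = measure lborel (ball 0 1 :: 'a set)"
  have V: "0 < V" by (simp add: V_def content_ball_pos)
  define B where "B = r + 2 - a"
  define G where "G t = 1/2 * exp (- \<beta> * (\<sigma> * t)) * (V * (1 / sqrt (2 * pi * (\<sigma> * t))) ^ DIM('a)
      * exp (- (A \<mu> * t + B)\<^sup>2 / (2 * (\<sigma> * t))))" for t
  define d where "d = real DIM('a)"
  have lnG: "ln (G t) = ln (V / 2) - \<beta> * \<sigma> * t - d * ln (sqrt (2 * pi * (\<sigma> * t))) - (A \<mu> * t + B)\<^sup>2 / (2 * (\<sigma> * t))"
    if "0 < t" for t
    using that V \<sigma> by (simp add: G_def d_def ln_mult ln_div ln_realpow power_one_over)
  have "((\<lambda>t. (1 / t) * (ln (V / 2) - \<beta> * \<sigma> * t - d * ln (sqrt (2 * pi * (\<sigma> * t))) - (A \<mu> * t + B)\<^sup>2 / (2 * (\<sigma> * t))))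
      \<longlongrightarrow> rate \<mu>) at_top"
    unfolding rate_def using \<sigma> tendsto_log_lower_rate[of \<sigma> "ln (V / 2)" "\<beta> * \<sigma>" d "A \<mu>" B] by simp
  then have "\<forall>\<^sub>F t in at_top. l < (1 / t) * (ln (V / 2) - \<beta> * \<sigma> * t - d * ln (sqrt (2 * pi * (\<sigma> * t))) - (A \<mu> * t + B)\<^sup>2 / (2 * (\<sigma> * t)))"
    using \<mu>(2) by (rule order_tendstoD)
  moreover have "\<forall>\<^sub>F t in at_top. a \<le> A \<mu> * t"
  proof -
    have "\<theta> * s0 < s0 * (1 - \<sigma>)" using \<sigma> s0 mult_strict_left_mono[of \<theta> "1 - \<sigma>" s0] by (simp add: mult.commute)
    also have "\<dots> \<le> \<mu> * s0 * (1 - \<sigma>)" using \<mu> s0 \<sigma> \<theta> by (intro mult_right_mono) auto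
    finally have "0 < A \<mu>" by (simp add: A_def)
    then show ?thesis by real_asymp
  qed
  moreover have "\<forall>\<^sub>F t in at_top. u1 \<le> (1 - \<sigma>) * t"
    using \<sigma> \<theta> by real_asymp
  ultimately show ?thesis
    using eventually_gt_at_top[of 0]
  proof eventually_elim
    case (elim t)
    have G: "0 < G t" using V \<sigma> elim by (simp add: G_def)
    have nx: "norm (x t) = a + \<theta> * s0 * t" using x elim by (simp add: s0_def)
    have "ennreal (G t) \<le> w ((1 - \<sigma>) * t + \<sigma> * t) (x t)"
    proof -
      have "\<mu> * s0 * ((1 - \<sigma>) * t) + r + 2 - norm (x t) = A \<mu> * t + B"
        unfolding nx by (simp add: A_def B_def algebra_simps)
      moreover have "norm (x t) \<le> \<mu> * s0 * ((1 - \<sigma>) * t) + r"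
        unfolding nx using elim r_pos by (simp add: A_def algebra_simps)
      ultimately show ?thesis
        using lower[of "(1 - \<sigma>) * t" "\<sigma> * t" "x t"] elim \<sigma> by (simp only: G_def V_def mult_pos_pos)
    qed
    then have "ennreal (G t) \<le> w t (x t)" by (simp add: algebra_simps)
    then have Gw: "G t \<le> enn2real (w t (x t))"
      using enn2real_mono[of "ennreal (G t)" "w t (x t)"] G neq_top_trans[OF ennreal_one_neq_top w_le_1[of t "x t"]]
      by (simp add: less_top)
    have "l < (1 / t) * ln (G t)" using elim lnG by simp
    also have "\<dots> \<le> (1 / t) * ln (enn2real (w t (x t)))"
      using Gw G elim by (intro mult_left_mono) auto
    finally show ?case using Gw G by simp
  qed
qed

lemma log_asymptotics_greater:
  assumes \<theta>: "0 \<le> \<theta>" "\<theta> < 1" and a: "0 \<le> a" and x: "\<And>t. 0 \<le> t \<Longrightarrow> norm (x t) = a + \<theta> * sqrt (2 * \<beta>) * t"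
    and L: "- 2 * \<beta> * (sqrt 2 - 1) * (1 - \<theta>) < l"
  shows "\<forall>\<^sub>F t in at_top. 0 < enn2real (w t (x t)) \<longrightarrow> (1 / t) * ln (enn2real (w t (x t))) < l"
proof -
  define s0 where "s0 = sqrt (2 * \<beta>)"
  have s0: "0 < s0" "s0\<^sup>2 = 2 * \<beta>" using \<beta>_pos by (auto simp: s0_def)
  \<comment> \<open>The positive root of b^2/2 + b s0 = \<beta>.\<close>
  define b0 where "b0 = s0 * (sqrt 2 - 1)"
  have b0: "0 < b0" using s0 by (simp add: b0_def)
  have b0\<beta>: "b0 * s0 + b0\<^sup>2 / 2 = \<beta>"
  proof -
    have "b0 * s0 + b0\<^sup>2 / 2 = s0\<^sup>2 * ((sqrt 2 - 1) + (sqrt 2 - 1)\<^sup>2 / 2)"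
      by (simp add: b0_def power2_eq_square algebra_simps)
    also have "(sqrt 2 - 1) + (sqrt 2 - 1)\<^sup>2 / 2 = 1/2"
      by (simp add: power2_eq_square algebra_simps diff_divide_distrib)
    finally show ?thesis by (simp add: s0)
  qed
  \<comment> \<open>Scaling slope \<open>b0\<close> and speed \<open>s0\<close> by \<mu> < 1 turns
    \<beta> in this identity into \<mu>^2 \<beta> < \<beta>, the strictness that
    \<open>w_upper_bound\<close> asks for.\<close>
  define rate where "rate \<mu> = - (\<mu> * b0) * (\<mu> * s0 - \<theta> * s0)" for \<mu>
  have "rate 1 = - s0\<^sup>2 * (sqrt 2 - 1) * (1 - \<theta>)"
    by (simp add: rate_def b0_def power2_eq_square algebra_simps)
  then have "rate 1 = - 2 * \<beta> * (sqrt 2 - 1) * (1 - \<theta>)" by (simp add: s0)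
  moreover have "(rate \<longlongrightarrow> rate 1) (at_left 1)"
    unfolding rate_def by (intro tendsto_intros)
  ultimately have "\<forall>\<^sub>F \<mu> in at_left 1. rate \<mu> < l"
    using L by (intro order_tendstoD) auto
  moreover have "\<forall>\<^sub>F \<mu> in at_left 1. 0 < (\<mu>::real)"
    by (rule eventually_at_leftI[of 0]) auto
  ultimately have "\<forall>\<^sub>F \<mu> in at_left 1. rate \<mu> < l \<and> 0 < \<mu>" by eventually_elim auto
  then obtain \<mu> where \<mu>: "0 < \<mu>" "\<mu> < 1" "rate \<mu> < l"
    unfolding eventually_at_left_field by (metis dense)
  have "\<mu> * \<mu> < 1 * 1" using \<mu> by (intro mult_strict_mono) auto
  then have "\<mu> * \<mu> < 1" by simp
  have "\<exists>K>0. \<exists>u0\<ge>0. \<forall>t\<ge>u0. \<forall>x. w t x \<le> ennreal (K * exp (\<mu> * b0 * norm x - \<mu> * b0 * (\<mu> * s0) * t))"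
  proof (rule w_upper_bound)
    have "(\<mu> * s0)\<^sup>2 < s0\<^sup>2" using \<mu> s0 by (intro power_strict_mono) auto
    then show "(\<mu> * s0)\<^sup>2 < 2 * \<beta>" by (simp add: s0)
    have "\<mu> * b0 * (\<mu> * s0) + (\<mu> * b0)\<^sup>2 / 2 = \<mu> * \<mu> * (b0 * s0 + b0\<^sup>2 / 2)"
      by (simp add: power2_eq_square algebra_simps)
    also have "\<dots> < \<beta>" unfolding b0\<beta> using \<open>\<mu> * \<mu> < 1\<close> \<beta>_pos by simp
    finally show "\<mu> * b0 * (\<mu> * s0) + (\<mu> * b0)\<^sup>2 / 2 < \<beta>" .
  qed (use \<mu> b0 s0 in auto)
  then obtain K u0 where K: "0 < K" and upper: "\<And>t x. u0 \<le> t \<Longrightarrow> w t x \<le> ennreal (K * exp (\<mu> * b0 * norm x - \<mu> * b0 * (\<mu> * s0) * t))"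
    by blast
  define k where "k = ln K + \<mu> * b0 * a"
  have "((\<lambda>t. (1 / t) * k + rate \<mu>) \<longlongrightarrow> 0 * k + rate \<mu>) at_top"
    by (intro tendsto_intros) real_asymp
  then have "\<forall>\<^sub>F t in at_top. (1 / t) * k + rate \<mu> < l"
    using \<mu>(3) by (intro order_tendstoD) auto
  then show ?thesis
    using eventually_gt_at_top[of 0] eventually_ge_at_top[of u0]
  proof eventually_elim
    case (elim t)
    have nx: "norm (x t) = a + \<theta> * s0 * t" using x elim by (simp add: s0_def)
    let ?E = "\<mu> * b0 * norm (x t) - \<mu> * b0 * (\<mu> * s0) * t"
    have "enn2real (w t (x t)) \<le> K * exp ?E"
      using enn2real_mono[OF upper[of t "x t"]] elim K by simp
    then have "(1 / t) * ln (enn2real (w t (x t))) \<le> (1 / t) * ln (K * exp ?E)" if "0 < enn2real (w t (x t))"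
      using that elim K by (intro mult_left_mono) (auto simp: ln_le_cancel_iff)
    also have "ln (K * exp ?E) = k + rate \<mu> * t"
      using K unfolding nx by (simp add: ln_mult k_def rate_def algebra_simps)
    also have "(1 / t) * (k + rate \<mu> * t) = (1 / t) * k + rate \<mu>"
      using elim by (simp add: field_simps)
    finally show ?case using elim by auto
  qed
qed

end

text \<open>The logarithm of 0 carries no information, so the upper estimate is stated only where
  \<open>w\<close> is positive; the lower estimate supplies this positivity for large times.\<close>

lemma (in kpp) log_asymptotics:
  assumes \<theta>: "0 \<le> \<theta>" "\<theta> < 1" and a: "0 \<le> a" and x: "\<And>t. 0 \<le> t \<Longrightarrow> norm (x t) = a + \<theta> * sqrt (2 * \<beta>) * t"
  shows "((\<lambda>t. (1 / t) * ln (enn2real (w t (x t)))) \<longlongrightarrow> - 2 * \<beta> * (sqrt 2 - 1) * (1 - \<theta>)) at_top"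
proof (rule order_tendstoI)
  have less: "\<forall>\<^sub>F t in at_top. 0 < enn2real (w t (x t)) \<and> l < (1 / t) * ln (enn2real (w t (x t)))"
    if "l < - 2 * \<beta> * (sqrt 2 - 1) * (1 - \<theta>)" for l
    by (rule log_asymptotics_less) fact+
  show "\<forall>\<^sub>F t in at_top. l < (1 / t) * ln (enn2real (w t (x t)))"
    if "l < - 2 * \<beta> * (sqrt 2 - 1) * (1 - \<theta>)" for l
    using less[OF that] by eventually_elim simp
  show "\<forall>\<^sub>F t in at_top. (1 / t) * ln (enn2real (w t (x t))) < l"
    if l: "- 2 * \<beta> * (sqrt 2 - 1) * (1 - \<theta>) < l" for l
  proof -
    have "\<forall>\<^sub>F t in at_top. 0 < enn2real (w t (x t)) \<longrightarrow> (1 / t) * ln (enn2real (w t (x t))) < l"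
      by (rule log_asymptotics_greater) fact+
    moreover have "- 2 * \<beta> * (sqrt 2 - 1) * (1 - \<theta>) - 1 < - 2 * \<beta> * (sqrt 2 - 1) * (1 - \<theta>)" by simp
    from less[OF this] have "\<forall>\<^sub>F t in at_top. 0 < enn2real (w t (x t))" by eventually_elim simp
    ultimately show ?thesis by eventually_elim simp
  qed
qed

section \<open>Return to the branching process\<close>

context dyadic_branching_brownian_motion
begin

text \<open>The source in \<open>avoid_renewal\<close> carries the labels of the children; label
  independence at nonnegative times, the only ones seen by \<open>Q_mono\<close>, closes the
  equation on the root label.\<close>

lemma kpp_avoid:
  assumes \<beta>: "0 < \<beta>" and r: "0 < r"
  shows "kpp M (W []) \<beta> r (avoid (ball 0 r) [])"
proof -
  interpret standard_brownian_motion M "W []" by (rule motion_brownian)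
  interpret branching_heat M "W []" \<beta> using \<beta> by unfold_locales
  have A: "ball (0::'a) r \<in> sets borel" by simp
  let ?w = "avoid (ball 0 r)"
  have eq: "?w v u y = ?w [] u y" if "0 \<le> u" for v u y
    using avoid_le_avoid[OF A \<beta> that] by (intro antisym)
  show ?thesis
  proof unfold_locales
    fix t x assume t: "0 \<le> (t::real)"
    show "?w [] t x = duhamel M (W []) \<beta> t (\<lambda>y. of_bool (y \<notin> ball 0 r)) (\<lambda>u y. ?w [] u y * ?w [] u y) x"
      unfolding avoid_renewal[OF A t \<beta>]
      by (intro antisym Q_mono) (simp_all add: eq[of _ "[False]"] eq[of _ "[True]"])
  qed (use r avoid_measurable[OF A] avoid_le_1 in auto)
qed

text \<open>By translation, a moving target seen from 0 is a fixed ball around 0 seen from the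
  moving starting point \<open>- (c + z)\<close>.\<close>

lemma measure_no_particle:
  "measure M {\<omega> \<in> space M. particle_count T W t (translate (ball c r) z) \<omega> = 0}
    = enn2real (avoid (ball 0 r) [] t (- (c + z)))"
proof -
  have A: "ball (0::'a) r \<in> sets borel" by simp
  let ?E = "{\<omega> \<in> space M. avoids T W (ball 0 r) [] t (- (c + z)) \<omega>}"
  have "p \<in> translate (ball c r) z \<longleftrightarrow> - (c + z) + p \<in> ball 0 r" for p :: 'a
  proof -
    have "p \<in> translate (ball c r) z \<longleftrightarrow> p - z \<in> ball c r"
      unfolding translate_def by (auto intro!: exI[of _ "p - z"])
    then show ?thesis by (simp add: dist_norm norm_minus_commute algebra_simps)
  qed
  then have "particle_count T W t (translate (ball c r) z) \<omega> = 0 \<longleftrightarrow> avoids T W (ball 0 r) [] t (- (c + z)) \<omega>" for \<omega>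
    by (auto simp: particle_count_def avoids_def emeasure_count_space_eq_0)
  then have "{\<omega> \<in> space M. particle_count T W t (translate (ball c r) z) \<omega> = 0} = ?E"
    by auto
  moreover have E: "?E \<in> events"
  proof -
    have "(\<lambda>\<omega>. of_bool (avoids T W (ball 0 r) [] t (- (c + z)) \<omega>) :: ennreal) \<in> borel_measurable M"
      by (rule of_bool_avoids_measurable[OF A]) measurable
    from measurable_sets[OF this, of "{1}"] show ?thesis by (simp add: vimage_def Int_def conj_commute)
  qed
  moreover have "avoid (ball 0 r) [] t (- (c + z)) = emeasure M ?E"
  proof -
    have "avoid (ball 0 r) [] t (- (c + z)) = (\<integral>\<^sup>+\<omega>. indicator ?E \<omega> \<partial>M)"
      unfolding avoid_def by (intro nn_integral_cong) (simp add: indicator_def)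
    also have "\<dots> = emeasure M ?E" by (rule nn_integral_indicator[OF E])
    finally show ?thesis .
  qed
  ultimately show ?thesis by (simp add: measure_def)
qed

end

theorem corollary2:
  fixes M :: "'w measure" and \<beta> \<theta> r :: real
    and T :: "bool list \<Rightarrow> 'w \<Rightarrow> real"
    and W :: "bool list \<Rightarrow> real \<Rightarrow> 'w \<Rightarrow> 'a::euclidean_space"
    and c e :: 'a
  assumes "\<beta> > 0"
    and "dyadic_branching_brownian_motion M \<beta> T W"
    and "0 \<le> \<theta>" and "\<theta> < 1"
    and "r > 0"
    and "norm e = 1"
    and "c \<noteq> 0 \<Longrightarrow> e = c /\<^sub>R norm c"
  shows "((\<lambda>t. (1 / t) * ln (measure M {\<omega> \<in> space M.
            particle_count T W t (translate (ball c r) ((\<theta> * sqrt (2 * \<beta>) * t) *\<^sub>R e)) \<omega> = 0}))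
          \<longlongrightarrow> - 2 * \<beta> * (sqrt 2 - 1) * (1 - \<theta>)) at_top"
proof -
  interpret dyadic_branching_brownian_motion M \<beta> T W by fact
  interpret kpp M "W []" \<beta> r "avoid (ball 0 r) []" by (rule kpp_avoid) fact+
  \<comment> \<open>This includes \<open>c = 0\<close>, where \<open>e\<close> is an arbitrary unit
    vector. Centre and shift are thus nonnegative multiples of the same unit vector, and their norms
    add exactly.\<close>
  have c: "c = norm c *\<^sub>R e" using assms(7) by (cases "c = 0") auto
  show ?thesis
    unfolding measure_no_particle
  proof (rule log_asymptotics[OF assms(3,4) norm_ge_zero[of c]])
    fix t :: real assume t: "0 \<le> t"
    have "c + (\<theta> * sqrt (2 * \<beta>) * t) *\<^sub>R e = (norm c + \<theta> * sqrt (2 * \<beta>) * t) *\<^sub>R e"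
      by (subst c) (simp add: scaleR_add_left)
    then show "norm (- (c + (\<theta> * sqrt (2 * \<beta>) * t) *\<^sub>R e)) = norm c + \<theta> * sqrt (2 * \<beta>) * t"
      using t assms(1,3,6) by (simp add: abs_of_nonneg)
  qed
qed

end
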